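(* \textsc{Balanced Partitioning} is fixed-parameter tractable with respect to the size $\tau$ of a minimum vertex cover of the input graph.
   Context: \textsc{Balanced Partitioning}: given a graph $G$ on $n$ vertices and positive integers $k$ and $d$, decide whether $V(G)$ can be partitioned into $d$ sets, each of size at most $\lceil n/d\rceil$, such that the number of edges whose endpoints lie in different sets is at most $k$. A vertex cover is a vertex set meeting every edge. Fixed-parameter tractable with respect to $\tau$ means solvable in $f(\tau)\cdot N^{O(1)}$ time for a computable function $f$, with $N$ the input size. *)

theory Defs
  imports Complex_Main "HOL-Library.Disjoint_Sets" "HOL-Library.Log_Nat"
begin

section \<open>Random access machines\<close>

text \<open>
  The model of computation is a random access machine over the natural numbers, presented as a
  structured programming language. The memory consists of named arrays with unboundedly many
  cells (a program mentions only finitely many names). Every elementary operation has unit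
  cost. The only arithmetic operations are addition and truncated subtraction; there is
  deliberately no multiplication, so the bit length of the largest number grows by at most one with
  each operation, and the model is equivalent to Turing machines up to polynomial overhead in
  the running time and the bit length of the input.
\<close>

type_synonym state = "string \<Rightarrow> nat \<Rightarrow> nat"

datatype aexp =
    Const nat
  | Read string aexp
  | Add aexp aexp
  | Sub aexp aexp

fun aval :: "aexp \<Rightarrow> state \<Rightarrow> nat" where
  "aval (Const c) s = c"
| "aval (Read x a) s = s x (aval a s)"
| "aval (Add a b) s = aval a s + aval b s"
| "aval (Sub a b) s = aval a s - aval b s"

fun acost :: "aexp \<Rightarrow> nat" where
  "acost (Const c) = 1"
| "acost (Read x a) = 1 + acost a"
| "acost (Add a b) = 1 + acost a + acost b"
| "acost (Sub a b) = 1 + acost a + acost b"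

text \<open>
  In \<open>Write x a b\<close> the value of \<open>b\<close> is stored in cell \<open>a\<close> of array \<open>x\<close>. Tests succeed
  if the value is nonzero; in particular \<open>Sub a b\<close> tests whether \<open>b < a\<close>.
\<close>

datatype com =
    Skip
  | Write string aexp aexp
  | Seq com com
  | Cond aexp com com
  | While aexp com

text \<open>\<open>exec c s t s'\<close>: started in \<open>s\<close>, program \<open>c\<close> halts after \<open>t\<close> steps in \<open>s'\<close>.\<close>

inductive exec :: "com \<Rightarrow> state \<Rightarrow> nat \<Rightarrow> state \<Rightarrow> bool" where
  Skip: "exec Skip s 1 s"
| Write: "exec (Write x a b) s (1 + acost a + acost b)
            (s(x := (s x)(aval a s := aval b s)))"
| Seq: "exec c1 s t1 s' \<Longrightarrow> exec c2 s' t2 s'' \<Longrightarrow> exec (Seq c1 c2) s (t1 + t2) s''"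
| CondTrue: "aval a s \<noteq> 0 \<Longrightarrow> exec c1 s t s' \<Longrightarrow> exec (Cond a c1 c2) s (1 + acost a + t) s'"
| CondFalse: "aval a s = 0 \<Longrightarrow> exec c2 s t s' \<Longrightarrow> exec (Cond a c1 c2) s (1 + acost a + t) s'"
| WhileFalse: "aval a s = 0 \<Longrightarrow> exec (While a c) s (1 + acost a) s"
| WhileTrue: "aval a s \<noteq> 0 \<Longrightarrow> exec c s t1 s' \<Longrightarrow> exec (While a c) s' t2 s'' \<Longrightarrow>
    exec (While a c) s (1 + acost a + t1 + t2) s''"

definition initial :: "nat list \<Rightarrow> state" where
  "initial xs = (\<lambda>x i.
     if x = ''in'' \<and> i < length xs then xs ! i
     else if x = ''len'' \<and> i = 0 then length xs
     else 0)"

definition result :: "state \<Rightarrow> nat" where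
  "result s = s ''out'' 0"

text \<open>Number of bits of the input; every number contributes one delimiter besides its digits.\<close>

definition input_size :: "nat list \<Rightarrow> nat" where
  "input_size xs = (\<Sum>x\<leftarrow>xs. 1 + floorlog 2 x)"

definition computable :: "(nat \<Rightarrow> nat) \<Rightarrow> bool" where
  "computable f \<longleftrightarrow> (\<exists>c. \<forall>x. \<exists>t s. exec c (initial [x]) t s \<and> result s = f x)"


section \<open>Fixed-parameter tractability\<close>

text \<open>
  A parameterized problem is given by its set of instances, their encoding, the yes-instances
  and the parameter. The algorithm is one fixed program, which receives only the encoded
  instance and not the parameter.
\<close>

definition fixed_parameter_tractable ::
  "'i set \<Rightarrow> ('i \<Rightarrow> nat list) \<Rightarrow> ('i \<Rightarrow> bool) \<Rightarrow> ('i \<Rightarrow> nat) \<Rightarrow> bool" where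
  "fixed_parameter_tractable I enc yes param \<longleftrightarrow>
     (\<exists>c f p. computable f \<and>
        (\<forall>x\<in>I. \<exists>t s. exec c (initial (enc x)) t s \<and>
                 result s = (if yes x then 1 else 0) \<and>
                 t \<le> f (param x) * input_size (enc x) ^ p))"


section \<open>Graphs and balanced partitions\<close>

definition simple_graph :: "'a set \<Rightarrow> 'a set set \<Rightarrow> bool" where
  "simple_graph V E \<longleftrightarrow> finite V \<and> (\<forall>e\<in>E. e \<subseteq> V \<and> card e = 2)"

definition vertex_cover :: "'a set \<Rightarrow> 'a set set \<Rightarrow> 'a set \<Rightarrow> bool" where
  "vertex_cover V E C \<longleftrightarrow> C \<subseteq> V \<and> (\<forall>e\<in>E. e \<inter> C \<noteq> {})"

definition vertex_cover_number :: "'a set \<Rightarrow> 'a set set \<Rightarrow> nat" where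
  "vertex_cover_number V E = (LEAST m. \<exists>C. vertex_cover V E C \<and> card C = m)"

definition cut_edges :: "'a set set \<Rightarrow> nat \<Rightarrow> (nat \<Rightarrow> 'a set) \<Rightarrow> 'a set set" where
  "cut_edges E d P =
     {{u, v} |u v. {u, v} \<in> E \<and> (\<exists>i<d. \<exists>j<d. i \<noteq> j \<and> u \<in> P i \<and> v \<in> P j)}"

text \<open>
  The \<open>d\<close> parts form a family indexed by \<open>{..<d}\<close>. As usual in graph partitioning, only an
  upper bound is imposed on their sizes, so parts may be empty.
\<close>

definition has_balanced_partition :: "'a set \<Rightarrow> 'a set set \<Rightarrow> nat \<Rightarrow> nat \<Rightarrow> bool" where
  "has_balanced_partition V E k d \<longleftrightarrow>
     (\<exists>P. disjoint_family_on P {..<d} \<and> (\<Union>i<d. P i) = V \<and>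
          (\<forall>i<d. int (card (P i)) \<le> \<lceil>real (card V) / real d\<rceil>) \<and>
          card (cut_edges E d P) \<le> k)"

text \<open>
  An instance \<open>(n, E, k, d)\<close> consists of a graph with vertex set \<open>{..<n}\<close> and edge set \<open>E\<close>
  and of the numbers \<open>k\<close> and \<open>d\<close>. The graph is encoded by its adjacency matrix, row by row;
  \<open>k\<close> and \<open>d\<close> are numbers of the input and hence contribute their binary length to its size.
\<close>

type_synonym bp_instance = "nat \<times> nat set set \<times> nat \<times> nat"

definition bp_instances :: "bp_instance set" where
  "bp_instances = {(n, E, k, d). simple_graph {..<n} E \<and> k > 0 \<and> d > 0}"

fun bp_encode :: "bp_instance \<Rightarrow> nat list" where
  "bp_encode (n, E, k, d) =
     [n, k, d] @ [if {u, v} \<in> E then 1 else 0. u \<leftarrow> [0..<n], v \<leftarrow> [0..<n]]"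

fun balanced_partitioning :: "bp_instance \<Rightarrow> bool" where
  "balanced_partitioning (n, E, k, d) \<longleftrightarrow> has_balanced_partition {..<n} E k d"

fun bp_vertex_cover_number :: "bp_instance \<Rightarrow> nat" where
  "bp_vertex_cover_number (n, E, k, d) = vertex_cover_number {..<n} E"

end

theory Submission
  imports Defs
begin

text \<open>
  A vertex cover \<open>C\<close> with at most \<open>2\<tau>\<close> vertices is found greedily. Once the parts of the cover vertices
  are guessed, distributing the remaining, pairwise nonadjacent vertices is a transportation problem:
  vertex \<open>v\<close> put into part \<open>i\<close> cuts its edges to the cover vertices outside \<open>i\<close>, and part \<open>i\<close> has bounded
  capacity. Its costs are at most \<open>|C|\<close> and it has at most \<open>|C| + 1\<close> sinks, so by linear programming
  duality there are optimal dual prices that are integers of size at most \<open>|C|\<^sup>2\<close>, namely the gains of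
  longest paths in the exchange graph of an optimal assignment. Instead of solving the transportation
  problem, the algorithm therefore tests the dual inequality for all these prices: the instance is
  accepted iff some guess passes the tests for all prices. The numbers of guesses and of prices depend
  on \<open>|C|\<close> only.
\<close>

section \<open>Integral duality for transportation problems\<close>

text \<open>The machine has no multiplication and every loop has to be verified together with its
  running time, so the program is kept to counted loops, sums and minima. This favours the dual: for
  fixed prices each vertex picks its cheapest sink independently of the others, whereas the primal
  problem couples the vertices through the capacities and would call for a flow algorithm. Exchange
  paths then occur in the correctness proof only.

  Two obstacles shape the rest. The number \<open>d\<close> is given in binary and may be
  exponential in the input size, so the parts cannot be enumerated; at most |C| of them meet the
  cover, and all others look alike. Moreover, testing boundedly many prices certifies a cost only if
  some assignment exists at all, since infeasibility shows up in the dual merely as unboundedness.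
  Feasibility of a guess is therefore tested separately, by counting cover vertices.\<close>

locale transport =
  fixes V :: "'v set" and S :: "'s set" and A :: "'v \<Rightarrow> 's set"
    and c :: "'v \<Rightarrow> 's \<Rightarrow> nat" and cp :: "'s \<Rightarrow> nat"
  assumes finV: "finite V" and finS: "finite S" and AS: "v \<in> V \<Longrightarrow> A v \<subseteq> S"
begin

definition load :: "('v \<Rightarrow> 's) \<Rightarrow> 's \<Rightarrow> nat" where
  "load y i = card {v \<in> V. y v = i}"

definition feasible :: "('v \<Rightarrow> 's) \<Rightarrow> bool" where
  "feasible y \<longleftrightarrow> (\<forall>v\<in>V. y v \<in> A v) \<and> (\<forall>i\<in>S. load y i \<le> cp i)"

definition cost :: "('v \<Rightarrow> 's) \<Rightarrow> nat" where
  "cost y = (\<Sum>v\<in>V. c v (y v))"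

text \<open>
  An exchange path is the list \<open>ws\<close> of the vertices to be moved, ending in the sink \<open>j\<close>: each
  vertex moves to the current sink of its successor, the last one to \<open>j\<close>.
\<close>

definition next_sink :: "('v \<Rightarrow> 's) \<Rightarrow> 'v list \<Rightarrow> 's \<Rightarrow> 's" where
  "next_sink y ws j = (case ws of [] \<Rightarrow> j | w # _ \<Rightarrow> y w)"

fun path :: "('v \<Rightarrow> 's) \<Rightarrow> 'v list \<Rightarrow> 's \<Rightarrow> bool" where
  "path y [] j \<longleftrightarrow> True"
| "path y (v # ws) j \<longleftrightarrow> v \<in> V \<and> next_sink y ws j \<in> A v \<and> path y ws j"

fun gain :: "('v \<Rightarrow> 's) \<Rightarrow> 'v list \<Rightarrow> 's \<Rightarrow> int" where
  "gain y [] j = 0"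
| "gain y (v # ws) j = int (c v (y v)) - int (c v (next_sink y ws j)) + gain y ws j"

lemma next_sink_simps [simp]:
  "next_sink y [] j = j" "next_sink y (w # ws) j = y w"
  by (simp_all add: next_sink_def)

lemma next_sink_append: "next_sink y (us @ w # ws) j = next_sink y us (y w)"
  by (cases us) auto

text \<open>Cutting at \<open>w\<close> leaves a front path that ends in the current sink of
  \<open>w\<close>. Together with the additivity of \<open>gain\<close> this splits a closed cycle
  off a longer path.\<close>

lemma path_append:
  "path y (us @ w # ws) j \<longleftrightarrow> path y us (y w) \<and> path y (w # ws) j"
  by (induction us) (auto simp: next_sink_append)

lemma gain_append:
  "gain y (us @ w # ws) j = gain y us (y w) + gain y (w # ws) j"
  by (induction us) (auto simp: next_sink_append)

lemma path_subset: "path y ws j \<Longrightarrow> set ws \<subseteq> V"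
  by (induction ws) auto

text \<open>Both sides carry a correction term, so that no subtraction of natural numbers occurs and
  the case \<open>j = y v\<close> is included.\<close>

lemma load_update:
  assumes "v \<in> V"
  shows "load (y(v := j)) i + of_bool (i = y v) = load y i + of_bool (i = j)"
proof -
  have load: "load z i = of_bool (z v = i) + card {w \<in> V - {v}. z w = i}" for z
  proof -
    have eq: "{w \<in> V. z w = i} = (if z v = i then {v} else {}) \<union> {w \<in> V - {v}. z w = i}"
      using assms by auto
    show ?thesis
      unfolding load_def eq using finV by (subst card_Un_disjoint) auto
  qed
  have rest: "{w \<in> V - {v}. (y(v := j)) w = i} = {w \<in> V - {v}. y w = i}"
    by auto
  show ?thesis
    unfolding load[of y] load[of "y(v := j)"] rest by auto
qed

lemma cost_update:
  assumes "v \<in> V"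
  shows "int (cost (y(v := j))) = int (cost y) - int (c v (y v)) + int (c v j)"
proof -
  have "cost z = c v (z v) + (\<Sum>w\<in>V - {v}. c w (z w))" for z
    unfolding cost_def using finV assms by (rule sum.remove)
  from this[of y] this[of "y(v := j)"] show ?thesis
    by simp
qed

text \<open>The tail is shifted before \<open>v\<close> moves. As the sinks on the path are
  distinct, the tail shift leaves \<open>v\<close> alone, and \<open>v\<close> then takes the place
  freed by its successor. Loads in between cancel. The clause on untouched sinks serves this
  induction.\<close>

lemma shift_along_path:
  assumes "\<forall>v\<in>V. y v \<in> A v" "path y ws j" "distinct (map y ws)" "ws \<noteq> []"
  shows "\<exists>y'. (\<forall>v\<in>V. y' v \<in> A v) \<and> (\<forall>v. y v \<notin> y ` set ws \<longrightarrow> y' v = y v) \<and>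
    int (cost y') = int (cost y) - gain y ws j \<and>
    (\<forall>i. load y' i + of_bool (i = y (hd ws)) = load y i + of_bool (i = j))"
  using assms(2-)
proof (induction ws)
  case Nil
  then show ?case by simp
next
  case (Cons v us)
  have "\<exists>y'. (\<forall>v\<in>V. y' v \<in> A v) \<and> (\<forall>v. y v \<notin> y ` set us \<longrightarrow> y' v = y v) \<and>
    int (cost y') = int (cost y) - gain y us j \<and>
    (\<forall>i. load y' i + of_bool (i = next_sink y us j) = load y i + of_bool (i = j))"
  \<comment> \<open>For an empty tail the sink to be filled is \<open>j\<close> itself and nothing
    has to move beforehand.\<close>
  proof (cases us)
    case Nil
    then show ?thesis using assms(1) by (intro exI[of _ y]) simp
  next
    case (Cons u us')
    then show ?thesis using Cons.IH Cons.prems by auto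
  qed
  then obtain y' where y': "\<forall>v\<in>V. y' v \<in> A v" "\<forall>v. y v \<notin> y ` set us \<longrightarrow> y' v = y v"
    "int (cost y') = int (cost y) - gain y us j"
    "\<forall>i. load y' i + of_bool (i = next_sink y us j) = load y i + of_bool (i = j)"
    by blast
  define k where "k = next_sink y us j"
  have v: "v \<in> V" "k \<in> A v" "y v \<notin> y ` set us" "y' v = y v"
    using Cons.prems y'(2) by (auto simp: k_def)
  have l: "load (y'(v := k)) i + of_bool (i = y v) = load y i + of_bool (i = j)" for i
    using load_update[OF v(1), of y' k i] y'(4)[rule_format, of i] v(4) by (simp add: k_def)
  have "int (cost (y'(v := k))) = int (cost y) - gain y (v # us) j"
    using cost_update[OF v(1), of y' k] y'(3) v(4) by (simp add: k_def)
  moreover have "\<forall>w. y w \<notin> y ` set (v # us) \<longrightarrow> (y'(v := k)) w = y w"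
    using y'(2) by auto
  moreover have "\<forall>w\<in>V. (y'(v := k)) w \<in> A w"
    using y'(1) v by auto
  ultimately show ?case using l by (intro exI[of _ "y'(v := k)"]) (simp del: fun_upd_apply)
qed

text \<open>Optimality excludes exchange cycles of positive gain, so maximal gains of simple paths
  behave like distances. The last two conclusions are the complementary slackness conditions: every
  vertex sits in a sink of least cost plus price, and a sink with spare room has price 0, because a
  path of positive gain ending there could be carried out. Integrality is free, as gains are
  integers.\<close>

lemma optimal_potentials:
  assumes y: "feasible y" and opt: "\<And>y'. feasible y' \<Longrightarrow> cost y \<le> cost y'"
    and bound: "\<And>v i. v \<in> V \<Longrightarrow> i \<in> S \<Longrightarrow> c v i \<le> M"
  obtains p :: "'s \<Rightarrow> nat"
  where "\<And>i. i \<in> S \<Longrightarrow> p i \<le> (card S - 1) * M"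
    and "\<And>v j. v \<in> V \<Longrightarrow> j \<in> A v \<Longrightarrow> c v (y v) + p (y v) \<le> c v j + p j"
    and "\<And>i. i \<in> S \<Longrightarrow> load y i < cp i \<Longrightarrow> p i = 0"
proof -
  have yA: "\<forall>v\<in>V. y v \<in> A v" and yS: "\<And>v. v \<in> V \<Longrightarrow> y v \<in> S"
    and cap: "\<And>i. i \<in> S \<Longrightarrow> load y i \<le> cp i"
    using y AS by (auto simp: feasible_def)
  \<comment> \<open>A path returning to its first sink changes no load, and a path into a sink with
    room overfills nothing. In both cases the shifted assignment is feasible and hence not
    cheaper.\<close>
  have cycle: "gain y ws j \<le> 0"
    if ws: "path y ws j" "distinct (map y ws)" "ws \<noteq> []" and le: "j = y (hd ws) \<or> j \<in> S \<and> load y j < cp j"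
    for ws j
  proof -
    obtain y' where y': "\<forall>v\<in>V. y' v \<in> A v" "int (cost y') = int (cost y) - gain y ws j"
      "\<forall>i. load y' i + of_bool (i = y (hd ws)) = load y i + of_bool (i = j)"
      using shift_along_path[OF yA ws] by blast
    have "load y' i \<le> cp i" if "i \<in> S" for i
      using y'(3)[rule_format, of i] cap[OF that] le by (auto simp: of_bool_def split: if_splits)
    then have "feasible y'" using y'(1) by (auto simp: feasible_def)
    then show ?thesis using opt[of y'] y'(2) by linarith
  qed
  txt \<open>
    The potential of a sink is the maximum gain of a simple exchange path ending there. Extending
    such a path either stays simple or closes a simple cycle, whose gain is not positive because
    \<open>y\<close> is optimal; so potentials exist without any removal of loops from walks.
  \<close>
  define W where "W j = {ws. path y ws j \<and> distinct (map y ws) \<and> j \<notin> y ` set ws}" for j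
  define P where "P j = Max ((\<lambda>ws. gain y ws j) ` W j)" for j
  have finW: "finite (W j)" for j
  proof (rule finite_subset)
    show "W j \<subseteq> {ws. set ws \<subseteq> V \<and> distinct ws}"
      unfolding W_def using path_subset by (auto simp: distinct_map)
    show "finite {ws. set ws \<subseteq> V \<and> distinct ws}"
      using finV by (rule finite_subset_distinct)
  qed
  have nil: "[] \<in> W j" for j by (simp add: W_def)
  have P_ge: "gain y ws j \<le> P j" if "ws \<in> W j" for ws j
    unfolding P_def using finW that by (intro Max_ge) auto
  have P_ex: "\<exists>ws\<in>W j. P j = gain y ws j" for j
  proof -
    have "P j \<in> (\<lambda>ws. gain y ws j) ` W j"
      unfolding P_def using finW nil by (intro Max_in) auto
    then show ?thesis by auto
  qed
  have P0: "0 \<le> P j" for j using P_ge[OF nil, of j] by simp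
  have gain_le: "gain y ws j \<le> int (length ws * M)" if "set ws \<subseteq> V" for ws j
    using that
  proof (induction ws)
    case (Cons v ws)
    then show ?case using bound[of v "y v"] yS[of v] by auto
  qed simp
  have P_le: "P j \<le> int ((card S - 1) * M)" if j: "j \<in> S" for j
  proof -
    obtain ws where ws: "ws \<in> W j" "P j = gain y ws j" using P_ex by blast
    have sub: "set ws \<subseteq> V" using ws path_subset by (auto simp: W_def)
    \<comment> \<open>The path has one vertex per sink and avoids \<open>j\<close>, whence the
      factor \<open>card S - 1\<close>.\<close>
    have "length ws = card (y ` set ws)"
      using ws by (simp add: W_def distinct_card[of "map y ws", simplified])
    also have "\<dots> \<le> card (S - {j})"
      using sub yS ws finS by (intro card_mono) (auto simp: W_def)
    finally have "length ws \<le> card S - 1" using j finS by simp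
    then have "length ws * M \<le> (card S - 1) * M" by simp
    then show ?thesis using gain_le[OF sub, of j] ws(2) by linarith
  qed
  have P_step: "int (c v (y v)) + P (y v) \<le> int (c v j) + P j" if v: "v \<in> V" "j \<in> A v" for v j
  proof (cases "j = y v")
    case False
    obtain ws where ws: "ws \<in> W (y v)" "P (y v) = gain y ws (y v)" using P_ex by blast
    have g: "gain y (ws @ [v]) j = gain y ws (y v) + int (c v (y v)) - int (c v j)"
      by (simp add: gain_append)
    have pa: "path y (ws @ [v]) j" "distinct (map y (ws @ [v]))"
      using ws(1) v by (auto simp: W_def path_append)
    show ?thesis
    proof (cases "j \<in> y ` set ws")
      case False
      then have "ws @ [v] \<in> W j"
        using pa \<open>j \<noteq> y v\<close> by (auto simp: W_def)
      then show ?thesis using P_ge[of "ws @ [v]" j] g ws(2) by linarith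
    next
      case True
      then obtain w ws1 ws2 where w: "ws = ws1 @ w # ws2" "y w = j"
        by (auto dest: split_list)
      have "ws1 \<in> W j"
        using ws(1) w by (auto simp: W_def path_append)
      then have "gain y ws1 j \<le> P j" by (rule P_ge)
      moreover have "gain y (w # ws2 @ [v]) j \<le> 0"
        using pa w by (intro cycle) (auto simp: path_append)
      moreover have "gain y (ws @ [v]) j = gain y ws1 j + gain y (w # ws2 @ [v]) j"
        using w gain_append[of y ws1 w "ws2 @ [v]" j] by simp
      ultimately show ?thesis using g ws(2) by linarith
    qed
  qed simp
  have P_slack: "P i = 0" if i: "i \<in> S" "load y i < cp i" for i
  proof -
    obtain ws where ws: "ws \<in> W i" "P i = gain y ws i" using P_ex by blast
    have "gain y ws i \<le> 0"
      using ws i by (cases "ws = []") (auto intro: cycle simp: W_def)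
    then show ?thesis using P0[of i] ws(2) by simp
  qed
  show thesis
  proof (rule that[of "\<lambda>i. nat (P i)"])
    show "nat (P i) \<le> (card S - 1) * M" if "i \<in> S" for i
      using P_le[OF that] by linarith
    show "c v (y v) + nat (P (y v)) \<le> c v j + nat (P j)" if "v \<in> V" "j \<in> A v" for v j
      using P_step[OF that] P0[of j] P0[of "y v"] by linarith
    show "nat (P i) = 0" if "i \<in> S" "load y i < cp i" for i
      using P_slack[OF that] by simp
  qed
qed

lemma sum_over_fibres:
  fixes p :: "'s \<Rightarrow> nat"
  assumes "\<forall>v\<in>V. y v \<in> A v"
  shows "(\<Sum>v\<in>V. p (y v)) = (\<Sum>i\<in>S. load y i * p i)"
proof -
  have "(\<Sum>v\<in>V. p (y v)) = (\<Sum>i\<in>S. \<Sum>v\<in>{v\<in>V. y v = i}. p (y v))"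
    using assms AS finV finS by (intro sum.group[symmetric]) auto
  also have "\<dots> = (\<Sum>i\<in>S. load y i * p i)"
    by (intro sum.cong) (auto simp: load_def)
  finally show ?thesis .
qed

text \<open>Weak duality: each vertex pays at least its minimum, and loads weighted by prices are at
  most capacities weighted by prices. Conversely, the potentials of an optimal assignment turn both
  estimates into equalities, and they lie below \<open>B\<close>, so integer prices below
  \<open>B\<close> are already decisive.\<close>

lemma duality:
  assumes ex: "\<exists>y. feasible y"
    and bound: "\<And>v i. v \<in> V \<Longrightarrow> i \<in> S \<Longrightarrow> c v i \<le> M"
    and B: "(card S - 1) * M < B"
  shows "(\<exists>y. feasible y \<and> cost y \<le> k) \<longleftrightarrow>
    (\<forall>p. (\<forall>i\<in>S. p i < B) \<longrightarrow>
      (\<Sum>v\<in>V. Min ((\<lambda>i. p i + c v i) ` A v)) \<le> k + (\<Sum>i\<in>S. cp i * p i))"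
    (is "?primal = ?dual")
proof
  have finA: "finite (A v)" if "v \<in> V" for v using AS[OF that] finS by (rule finite_subset)
  {
    assume ?primal
    then obtain y where y: "feasible y" "cost y \<le> k" by blast
    have yA: "\<forall>v\<in>V. y v \<in> A v" using y by (simp add: feasible_def)
    show ?dual
    proof (intro allI impI)
      fix p :: "'s \<Rightarrow> nat"
      have "(\<Sum>v\<in>V. Min ((\<lambda>i. p i + c v i) ` A v)) \<le> (\<Sum>v\<in>V. p (y v) + c v (y v))"
        using yA finA by (intro sum_mono Min_le) auto
      also have "\<dots> = (\<Sum>i\<in>S. load y i * p i) + cost y"
        by (simp add: sum.distrib sum_over_fibres[OF yA] cost_def)
      also have "\<dots> \<le> (\<Sum>i\<in>S. cp i * p i) + k"
        using y by (intro add_mono sum_mono) (auto simp: feasible_def)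
      finally show "(\<Sum>v\<in>V. Min ((\<lambda>i. p i + c v i) ` A v)) \<le> k + (\<Sum>i\<in>S. cp i * p i)"
        by simp
    qed
  }
  assume dual: ?dual
  define y where "y = arg_min cost feasible"
  have y: "feasible y" "\<And>y'. feasible y' \<Longrightarrow> cost y \<le> cost y'"
    using ex arg_min_nat_lemma[of feasible _ cost] by (auto simp: y_def)
  obtain p where p: "\<And>i. i \<in> S \<Longrightarrow> p i \<le> (card S - 1) * M"
    "\<And>v j. v \<in> V \<Longrightarrow> j \<in> A v \<Longrightarrow> c v (y v) + p (y v) \<le> c v j + p j"
    "\<And>i. i \<in> S \<Longrightarrow> load y i < cp i \<Longrightarrow> p i = 0"
    using optimal_potentials[OF y bound] by blast
  have yA: "\<forall>v\<in>V. y v \<in> A v" using y by (simp add: feasible_def)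
  \<comment> \<open>Complementary slackness: the sink is full or its price is 0.\<close>
  have "load y i * p i = cp i * p i" if "i \<in> S" for i
    using y(1) p(3)[OF that] that by (cases "load y i = cp i") (auto simp: feasible_def le_less)
  then have "(\<Sum>i\<in>S. load y i * p i) = (\<Sum>i\<in>S. cp i * p i)"
    by (rule sum.cong[OF refl])
  then have "cost y + (\<Sum>i\<in>S. cp i * p i) = cost y + (\<Sum>v\<in>V. p (y v))"
    by (simp add: sum_over_fibres[OF yA])
  also have "\<dots> = (\<Sum>v\<in>V. c v (y v) + p (y v))"
    by (simp add: sum.distrib cost_def)
  also have "\<dots> \<le> (\<Sum>v\<in>V. Min ((\<lambda>i. p i + c v i) ` A v))"
  proof (rule sum_mono)
    fix v assume v: "v \<in> V"
    show "c v (y v) + p (y v) \<le> Min ((\<lambda>i. p i + c v i) ` A v)"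
      using v yA finA p(2)[OF v] by (subst Min_ge_iff) (auto simp: add.commute)
  qed
  also have "\<dots> \<le> k + (\<Sum>i\<in>S. cp i * p i)"
    using dual p(1) B by (meson le_less_trans)
  finally show ?primal using y(1) by auto
qed

end

section \<open>Balanced partitions and the transportation problem of a guess\<close>

definition part_bound :: "nat \<Rightarrow> nat \<Rightarrow> nat" where
  "part_bound n d = nat \<lceil>real n / real d\<rceil>"

text \<open>Describes the ceiling by comparing a product with \<open>n\<close>, the form in which
  repeated subtraction of \<open>d\<close> computes it.\<close>

lemma less_part_bound_iff: "d > 0 \<Longrightarrow> j < part_bound n d \<longleftrightarrow> j * d < n"
proof -
  assume d: "d > 0"
  have "j < part_bound n d \<longleftrightarrow> int j < \<lceil>real n / real d\<rceil>"
    by (simp add: part_bound_def zless_nat_eq_int_zless)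
  also have "\<dots> \<longleftrightarrow> real j < real n / real d"
    by (simp add: less_ceiling_iff)
  also have "\<dots> \<longleftrightarrow> real (j * d) < real n"
    using d by (simp add: pos_less_divide_eq)
  finally show ?thesis by (simp only: of_nat_less_iff)
qed

lemma le_part_bound_mult: "d > 0 \<Longrightarrow> n \<le> part_bound n d * d"
  using less_part_bound_iff[of d "part_bound n d" n] by simp

lemma part_bound_le: "d > 0 \<Longrightarrow> part_bound n d \<le> n"
  using less_part_bound_iff[of d n n] by (simp add: not_less[symmetric])

lemma int_le_part_bound_iff: "int a \<le> \<lceil>real n / real d\<rceil> \<longleftrightarrow> a \<le> part_bound n d"
proof -
  have "0 \<le> \<lceil>real n / real d\<rceil>"
    by (simp add: order_less_le_trans[of "-1" 0])
  then show ?thesis by (auto simp: part_bound_def le_nat_iff)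
qed

text \<open>The sinks are filled one after the other, each as far as possible. This serves to spread
  the pooled sink over actual parts and to place the vertices outside the cover when an assignment
  has to be exhibited.\<close>

lemma ex_bounded_distribution:
  fixes r :: "'b \<Rightarrow> nat"
  assumes "finite I" "finite A" "card A \<le> sum r I"
  shows "\<exists>g. (\<forall>a\<in>A. g a \<in> I) \<and> (\<forall>i\<in>I. card {a\<in>A. g a = i} \<le> r i)"
  using assms
proof (induction I arbitrary: A rule: finite_induct)
  case empty
  then show ?case by simp
next
  case (insert i I)
  obtain D where D: "D \<subseteq> A" "card D = min (r i) (card A)"
    using obtain_subset_with_card_n[of "min (r i) (card A)" A] by auto
  have "card (A - D) \<le> sum r I"
    using insert D by (subst card_Diff_subset) (auto dest: finite_subset)
  then obtain g where g: "\<forall>a\<in>A - D. g a \<in> I" "\<forall>j\<in>I. card {a\<in>A - D. g a = j} \<le> r j"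
    using insert.IH[of "A - D"] insert.prems by auto
  define h where "h a = (if a \<in> D then i else g a)" for a
  have "{a\<in>A. h a = i} = D"
    using g D insert.hyps by (auto simp: h_def)
  moreover have "{a\<in>A. h a = j} = {a\<in>A - D. g a = j}" if "j \<in> I" for j
    using that insert.hyps by (auto simp: h_def)
  ultimately show ?case
    using g D by (intro exI[of _ h]) (auto simp: h_def)
qed

section \<open>Partitions as labellings, and renaming of parts\<close>

definition cut :: "nat set set \<Rightarrow> (nat \<Rightarrow> nat) \<Rightarrow> nat set set" where
  "cut E x = {{u, v} |u v. {u, v} \<in> E \<and> x u \<noteq> x v}"

lemma has_balanced_partition_iff:
  assumes G: "simple_graph {..<n} E"
  shows "has_balanced_partition {..<n} E k d \<longleftrightarrow>
    (\<exists>x. (\<forall>v<n. x v < d) \<and> (\<forall>i<d. card {v\<in>{..<n}. x v = i} \<le> part_bound n d) \<and>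
      card (cut E x) \<le> k)"
proof -
  have E: "u < n" "v < n" if "{u, v} \<in> E" for u v
    using G that by (auto simp: simple_graph_def)
  have cut: "cut_edges E d P = cut E x"
    if xP: "\<forall>v<n. x v < d" "\<forall>i<d. P i = {v\<in>{..<n}. x v = i}" for P x
  proof -
    have "(\<exists>i<d. \<exists>j<d. i \<noteq> j \<and> u \<in> P i \<and> v \<in> P j) \<longleftrightarrow> x u \<noteq> x v" if e: "{u, v} \<in> E" for u v
    proof
      assume "x u \<noteq> x v"
      then show "\<exists>i<d. \<exists>j<d. i \<noteq> j \<and> u \<in> P i \<and> v \<in> P j"
        using E[OF e] xP by (intro exI[of _ "x u"] exI[of _ "x v"]) auto
    qed (use xP in auto)
    then have "(e = {u, v} \<and> {u, v} \<in> E \<and> (\<exists>i<d. \<exists>j<d. i \<noteq> j \<and> u \<in> P i \<and> v \<in> P j)) \<longleftrightarrow>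
        (e = {u, v} \<and> {u, v} \<in> E \<and> x u \<noteq> x v)" for e u v
      by blast
    then show ?thesis unfolding cut_edges_def cut_def by simp
  qed
  show ?thesis
  proof
    assume "has_balanced_partition {..<n} E k d"
    then obtain P where P: "disjoint_family_on P {..<d}" "(\<Union>i<d. P i) = {..<n}"
      "\<forall>i<d. card (P i) \<le> part_bound n d" "card (cut_edges E d P) \<le> k"
      by (auto simp: has_balanced_partition_def int_le_part_bound_iff)
    have "\<forall>v. \<exists>i. v < n \<longrightarrow> i < d \<and> v \<in> P i"
      using P(2) by blast
    then obtain x where x: "\<forall>v<n. x v < d \<and> v \<in> P (x v)"
      by metis
    have "P i = {v\<in>{..<n}. x v = i}" if i: "i < d" for i
    proof -
      have "v < n" if "v \<in> P i" for v using P(2) i that by blast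
      moreover have "x v = i" if "v \<in> P i" for v
        using P(1) x i that \<open>v \<in> P i \<Longrightarrow> v < n\<close>
        by (auto simp: disjoint_family_on_def)
      ultimately show ?thesis using x by auto
    qed
    then show "\<exists>x. (\<forall>v<n. x v < d) \<and> (\<forall>i<d. card {v\<in>{..<n}. x v = i} \<le> part_bound n d) \<and>
      card (cut E x) \<le> k"
      using x P cut[of x P] by (intro exI[of _ x]) auto
  next
    assume "\<exists>x. (\<forall>v<n. x v < d) \<and> (\<forall>i<d. card {v\<in>{..<n}. x v = i} \<le> part_bound n d) \<and>
      card (cut E x) \<le> k"
    then obtain x where x: "\<forall>v<n. x v < d" "\<forall>i<d. card {v\<in>{..<n}. x v = i} \<le> part_bound n d"
      "card (cut E x) \<le> k" by blast
    show "has_balanced_partition {..<n} E k d"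
      unfolding has_balanced_partition_def int_le_part_bound_iff card_lessThan
      using x cut[of x "\<lambda>i. {v\<in>{..<n}. x v = i}"]
      by (intro exI[of _ "\<lambda>i. {v\<in>{..<n}. x v = i}"]) (auto simp: disjoint_family_on_def)
  qed
qed

lemma cut_comp_inj:
  assumes "simple_graph {..<n} E" "\<forall>v<n. x v < d" "inj_on \<pi> {..<d}"
  shows "cut E (\<pi> \<circ> x) = cut E x"
proof -
  have "u < n" "v < n" if "{u, v} \<in> E" for u v
    using assms(1) that by (auto simp: simple_graph_def)
  then have "\<pi> (x u) = \<pi> (x v) \<longleftrightarrow> x u = x v" if "{u, v} \<in> E" for u v
    using assms(2) that inj_on_eq_iff[OF assms(3), of "x u" "x v"] by auto
  then have "(e = {u, v} \<and> {u, v} \<in> E \<and> (\<pi> \<circ> x) u \<noteq> (\<pi> \<circ> x) v) \<longleftrightarrow>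
      (e = {u, v} \<and> {u, v} \<in> E \<and> x u \<noteq> x v)" for e u v
    by auto
  then show ?thesis unfolding cut_def by simp
qed

text \<open>\<open>T\<close> is mapped to an initial segment and its complement to the rest.
  Renaming changes neither the cut nor the list of part sizes up to order, so the parts met by the
  cover may be assumed to come first.\<close>

lemma ex_bij_into_prefix:
  assumes "T \<subseteq> {..<d::nat}" "card T \<le> q"
  shows "\<exists>\<pi>. bij_betw \<pi> {..<d} {..<d} \<and> \<pi> ` T \<subseteq> {..<q}"
proof -
  have T: "finite T" "card T \<le> d"
    using assms(1) finite_subset card_mono[OF _ assms(1)] by auto
  obtain f where f: "bij_betw f T {..<card T}"
    using T(1) ex_bij_betw_finite_nat[of T] by (auto simp: atLeast0LessThan)
  have "card ({..<d} - T) = card {card T..<d}"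
    using assms(1) T by (simp add: card_Diff_subset)
  then obtain g where g: "bij_betw g ({..<d} - T) {card T..<d}"
    using finite_same_card_bij[of "{..<d} - T" "{card T..<d}"] by auto
  define \<pi> where "\<pi> i = (if i \<in> T then f i else g i)" for i
  have "bij_betw \<pi> T {..<card T}"
    using f by (rule bij_betw_cong[THEN iffD1, rotated]) (simp add: \<pi>_def)
  moreover have "bij_betw \<pi> ({..<d} - T) {card T..<d}"
    using g by (rule bij_betw_cong[THEN iffD1, rotated]) (simp add: \<pi>_def)
  ultimately have "bij_betw \<pi> (T \<union> ({..<d} - T)) ({..<card T} \<union> {card T..<d})"
    by (rule bij_betw_combine) auto
  moreover have "T \<union> ({..<d} - T) = {..<d}" "{..<card T} \<union> {card T..<d} = {..<d}"
    using assms(1) T(2) by auto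
  moreover have "\<pi> ` T \<subseteq> {..<q}"
    using \<open>bij_betw \<pi> T {..<card T}\<close> assms(2) by (auto simp: bij_betw_def)
  ultimately show ?thesis by auto
qed

locale covered_graph =
  fixes n :: nat and E :: "nat set set" and k d :: nat and C :: "nat set"
  assumes graph: "simple_graph {..<n} E" and d: "d > 0"
    and cover: "vertex_cover {..<n} E C"
begin

text \<open>
  Cover vertices meet at most \<open>q\<close> parts, which by symmetry are the parts \<open>0, \<dots>, q - 1\<close>. The
  remaining \<open>d - q\<close> parts contain no cover vertex, so all their edges are cut, and they are pooled
  into the single sink \<open>q\<close>.
\<close>

definition q :: nat where "q = min (card C) d"

definition sink_cap :: "nat \<Rightarrow> nat" where
  "sink_cap i = (if i < q then part_bound n d else (d - q) * part_bound n d)"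

text \<open>
  An edge is charged to its endpoint outside the cover, or to the larger endpoint if both are
  cover vertices.
\<close>

definition cut_cost :: "(nat \<Rightarrow> nat) \<Rightarrow> nat \<Rightarrow> nat \<Rightarrow> nat" where
  "cut_cost \<alpha> v i = card {u \<in> C. {v, u} \<in> E \<and> \<alpha> u \<noteq> i \<and> (v \<in> C \<longrightarrow> u < v)}"

text \<open>Cover vertices stay in the transportation problem with a single admissible sink. The
  room they use and the edges among them are thus covered by the same formulas as everything
  else.\<close>

definition sinks :: "(nat \<Rightarrow> nat) \<Rightarrow> nat \<Rightarrow> nat set" where
  "sinks \<alpha> v = (if v \<in> C then {\<alpha> v} else {..q})"

text \<open>Only the vertex part of the dual objective; the capacity term stands on the other side
  of the inequality, which avoids a subtraction.\<close>

definition dual :: "(nat \<Rightarrow> nat) \<Rightarrow> (nat \<Rightarrow> nat) \<Rightarrow> nat" where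
  "dual \<alpha> p = (\<Sum>v<n. Min ((\<lambda>i. p i + cut_cost \<alpha> v i) ` sinks \<alpha> v))"

text \<open>For labels below \<open>q\<close> the counting condition is equivalent to feasibility of
  the whole problem: the other vertices may use every sink, and the total capacity is at least
  \<open>n\<close>.\<close>

definition guess_ok :: "(nat \<Rightarrow> nat) \<Rightarrow> bool" where
  "guess_ok \<alpha> \<longleftrightarrow> (\<forall>u\<in>C. \<alpha> u < q) \<and> (\<forall>i<q. card {u\<in>C. \<alpha> u = i} \<le> part_bound n d)"

lemma C_sub: "C \<subseteq> {..<n}" and fin_C [simp]: "finite C"
  using cover finite_subset by (auto simp: vertex_cover_def)

lemma edge: "{u, v} \<in> E \<Longrightarrow> u < n \<and> v < n \<and> u \<noteq> v \<and> (u \<in> C \<or> v \<in> C)"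
  using graph cover by (fastforce simp: simple_graph_def vertex_cover_def)

text \<open>The pairs \<open>(v, u)\<close> counted on the right correspond to the cut edges: an
  edge with one end in the cover can only be read with \<open>u\<close> as that end, and
  \<open>u < v\<close> selects one of the two readings of an edge inside the cover.\<close>

lemma card_cut:
  "card (cut E x) = (\<Sum>v<n. card {u \<in> C. {v, u} \<in> E \<and> x u \<noteq> x v \<and> (v \<in> C \<longrightarrow> u < v)})"
proof -
  let ?N = "\<lambda>v. {u \<in> C. {v, u} \<in> E \<and> x u \<noteq> x v \<and> (v \<in> C \<longrightarrow> u < v)}"
  have "bij_betw (\<lambda>(v, u). {v, u}) (SIGMA v:{..<n}. ?N v) (cut E x)"
  proof (rule bij_betw_imageI)
    show "inj_on (\<lambda>(v, u). {v, u}) (SIGMA v:{..<n}. ?N v)"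
      by (rule inj_onI) (force simp: doubleton_eq_iff)
    show "(\<lambda>(v, u). {v, u}) ` (SIGMA v:{..<n}. ?N v) = cut E x"
    proof (intro equalityI subsetI)
      fix e assume "e \<in> (\<lambda>(v, u). {v, u}) ` (SIGMA v:{..<n}. ?N v)"
      then show "e \<in> cut E x" by (fastforce simp: cut_def)
    next
      fix e assume "e \<in> cut E x"
      then obtain u v where e: "e = {u, v}" "{u, v} \<in> E" "x u \<noteq> x v"
        by (auto simp: cut_def)
      have uv: "u < n" "v < n" "u \<noteq> v" "u \<in> C \<or> v \<in> C" using edge[OF e(2)] by auto
      have "u \<in> ?N v \<or> v \<in> ?N u"
        using e uv by (auto simp: insert_commute)
      then show "e \<in> (\<lambda>(v, u). {v, u}) ` (SIGMA v:{..<n}. ?N v)"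
      proof
        assume "u \<in> ?N v"
        then show ?thesis using uv e by (intro image_eqI[of _ _ "(v, u)"]) (auto simp: insert_commute)
      next
        assume "v \<in> ?N u"
        then show ?thesis using uv e by (intro image_eqI[of _ _ "(u, v)"]) auto
      qed
    qed
  qed
  then show ?thesis
    by (subst bij_betw_same_card[symmetric]) (auto simp: card_SigmaI)
qed

lemma q_le_d: "q \<le> d" by (simp add: q_def)

lemma q_le_card: "q \<le> card C" by (simp add: q_def)

lemma transport: "guess_ok \<alpha> \<Longrightarrow> transport {..<n} {..q} (sinks \<alpha>)"
  by unfold_locales (auto simp: sinks_def guess_ok_def less_imp_le)

text \<open>From left to right, the parts are renamed so that those meeting the cover come first,
  and the others are merged. From right to left, the pool is distributed over \<open>d - q\<close>
  parts. The cost is the same because labels are only compared with those of cover vertices, which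
  stay below \<open>q\<close>.\<close>

lemma balanced_iff_transport:
  "has_balanced_partition {..<n} E k d \<longleftrightarrow>
    (\<exists>\<alpha>. guess_ok \<alpha> \<and> (\<exists>y. transport.feasible {..<n} {..q} (sinks \<alpha>) sink_cap y \<and>
      transport.cost {..<n} (cut_cost \<alpha>) y \<le> k))" (is "_ \<longleftrightarrow> ?R")
proof
  assume "has_balanced_partition {..<n} E k d"
  then obtain x where x: "\<forall>v<n. x v < d" "\<forall>i<d. card {v\<in>{..<n}. x v = i} \<le> part_bound n d"
    "card (cut E x) \<le> k"
    using has_balanced_partition_iff[OF graph] by blast
  have "x ` C \<subseteq> {..<d}" using x(1) C_sub by auto
  moreover have "card (x ` C) \<le> q"
    using card_mono[OF _ \<open>x ` C \<subseteq> {..<d}\<close>] card_image_le[OF fin_C, of x] by (simp add: q_def)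
  ultimately obtain \<pi> where \<pi>: "bij_betw \<pi> {..<d} {..<d}" "\<pi> ` x ` C \<subseteq> {..<q}"
    using ex_bij_into_prefix by blast
  define \<alpha> where "\<alpha> = \<pi> \<circ> x"
  have \<alpha>d: "\<alpha> v < d" if "v < n" for v
    using \<pi>(1) x(1) that by (auto simp: \<alpha>_def bij_betw_def)
  have \<alpha>q: "\<alpha> u < q" if "u \<in> C" for u
    using \<pi>(2) that by (auto simp: \<alpha>_def)
  have fibre: "card {v\<in>{..<n}. \<alpha> v = i} \<le> part_bound n d" if "i < d" for i
  proof -
    have "i \<in> \<pi> ` {..<d}"
      using bij_betw_imp_surj_on[OF \<pi>(1)] that by simp
    then obtain j where j: "j < d" "\<pi> j = i" by blast
    have "\<alpha> v = i \<longleftrightarrow> x v = j" if "v < n" for v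
      using inj_on_eq_iff[OF bij_betw_imp_inj_on[OF \<pi>(1)], of "x v" j] x(1) j that
      by (simp add: \<alpha>_def)
    then have "{v\<in>{..<n}. \<alpha> v = i} = {v\<in>{..<n}. x v = j}"
      by auto
    then show ?thesis using x(2) j by simp
  qed
  have cut: "card (cut E \<alpha>) \<le> k"
    using x(3) cut_comp_inj[OF graph x(1) bij_betw_imp_inj_on[OF \<pi>(1)]] by (simp add: \<alpha>_def)
  \<comment> \<open>All labels from \<open>q\<close> on collapse into the pooled sink.\<close>
  define y where "y v = min (\<alpha> v) q" for v
  have ok: "guess_ok \<alpha>"
    unfolding guess_ok_def
  proof (intro conjI ballI allI impI)
    fix i assume "i < q"
    have "card {u\<in>C. \<alpha> u = i} \<le> card {v\<in>{..<n}. \<alpha> v = i}"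
      using C_sub by (intro card_mono) auto
    also have "\<dots> \<le> part_bound n d" using fibre \<open>i < q\<close> q_le_d by simp
    finally show "card {u\<in>C. \<alpha> u = i} \<le> part_bound n d" .
  qed (rule \<alpha>q)
  then interpret transport "{..<n}" "{..q}" "sinks \<alpha>" "cut_cost \<alpha>" sink_cap
    by (rule transport)
  have "load y i \<le> sink_cap i" if "i \<le> q" for i
  proof (cases "i < q")
    case True
    then have "{v\<in>{..<n}. y v = i} = {v\<in>{..<n}. \<alpha> v = i}"
      by (auto simp: y_def min_def)
    then show ?thesis using fibre[of i] True q_le_d by (simp add: load_def sink_cap_def)
  next
    case False
    with that have "i = q" by simp
    have "q \<le> \<alpha> v \<and> \<alpha> v < d" if "v < n" "y v = q" for v
      using \<alpha>d that by (simp add: y_def)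
    then have "{v\<in>{..<n}. y v = q} \<subseteq> (\<Union>j\<in>{q..<d}. {v\<in>{..<n}. \<alpha> v = j})"
      by auto
    then have "load y q \<le> card (\<Union>j\<in>{q..<d}. {v\<in>{..<n}. \<alpha> v = j})"
      unfolding load_def by (intro card_mono) auto
    also have "\<dots> \<le> (\<Sum>j\<in>{q..<d}. card {v\<in>{..<n}. \<alpha> v = j})"
      by (rule card_UN_le) simp
    also have "\<dots> \<le> (\<Sum>j\<in>{q..<d}. part_bound n d)"
      by (intro sum_mono fibre) auto
    finally show ?thesis using \<open>i = q\<close> by (simp add: sink_cap_def)
  qed
  moreover have "\<forall>v<n. y v \<in> sinks \<alpha> v"
    using \<alpha>q by (auto simp: y_def sinks_def min_def less_imp_le)
  ultimately have "feasible y" by (auto simp: feasible_def)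
  moreover have "cost y = card (cut E \<alpha>)"
    unfolding cost_def card_cut cut_cost_def
  proof (intro sum.cong refl arg_cong[where f = card] Collect_cong conj_cong)
    show "\<alpha> u \<noteq> y v \<longleftrightarrow> \<alpha> u \<noteq> \<alpha> v" if "u \<in> C" for u v
      using \<alpha>q[OF that] by (auto simp: y_def)
  qed
  ultimately have "feasible y \<and> cost y \<le> k" using cut by simp
  then show ?R using ok by blast
next
  assume ?R
  then obtain \<alpha> y where ok: "guess_ok \<alpha>"
    and y: "transport.feasible {..<n} {..q} (sinks \<alpha>) sink_cap y"
      "transport.cost {..<n} (cut_cost \<alpha>) y \<le> k" by blast
  interpret transport "{..<n}" "{..q}" "sinks \<alpha>" "cut_cost \<alpha>" sink_cap
    using ok by (rule transport)
  have yA: "y v \<in> sinks \<alpha> v" if "v < n" for v using y(1) that by (simp add: feasible_def)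
  have yq: "y v \<le> q" if "v < n" for v using yA[OF that] AS[of v] that by auto
  have load: "card {v\<in>{..<n}. y v = i} \<le> sink_cap i" if "i \<le> q" for i
    using y(1) that by (simp add: feasible_def load_def)
  have y\<alpha>: "y u = \<alpha> u" if "u \<in> C" for u
    using yA[of u] C_sub that by (auto simp: sinks_def)
  have \<alpha>q: "\<alpha> u < q" if "u \<in> C" for u using ok that by (simp add: guess_ok_def)
  define W where "W = {v\<in>{..<n}. y v = q}"
  have "card W \<le> (\<Sum>i\<in>{q..<d}. part_bound n d)"
    using load[of q] by (simp add: W_def sink_cap_def)
  then obtain g where g: "\<forall>v\<in>W. g v \<in> {q..<d}"
    "\<forall>i\<in>{q..<d}. card {v\<in>W. g v = i} \<le> part_bound n d"
    using ex_bounded_distribution[of "{q..<d}" W "\<lambda>_. part_bound n d"] by (auto simp: W_def)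
  define x where "x v = (if v \<in> W then g v else y v)" for v
  have "card {v\<in>{..<n}. x v = i} \<le> part_bound n d" if i: "i < d" for i
  proof (cases "i < q")
    case True
    then have "{v\<in>{..<n}. x v = i} = {v\<in>{..<n}. y v = i}"
      using g(1) by (auto simp: x_def W_def)
    then show ?thesis using load[of i] True by (simp add: sink_cap_def)
  next
    case False
    have "x v = i \<longleftrightarrow> v \<in> W \<and> g v = i" if "v < n" for v
      using yq[OF that] False that by (auto simp: x_def W_def)
    then have "{v\<in>{..<n}. x v = i} = {v\<in>W. g v = i}"
      by (auto simp: W_def)
    then show ?thesis using g(2) False i by simp
  qed
  moreover have "x v < d" if "v < n" for v
    using g(1) yq[OF that] q_le_d that by (fastforce simp: x_def W_def)
  moreover have "card (cut E x) = cost y"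
    unfolding cost_def card_cut cut_cost_def
  proof (intro sum.cong refl arg_cong[where f = card] Collect_cong conj_cong)
    \<comment> \<open>A pooled vertex is separated from every cover vertex, whichever of the parts
      from \<open>q\<close> on it receives.\<close>
    show "x u \<noteq> x v \<longleftrightarrow> \<alpha> u \<noteq> y v" if "v \<in> {..<n}" "u \<in> C" for u v
      using \<alpha>q[OF that(2)] y\<alpha>[OF that(2)] g(1) that by (auto simp: x_def W_def)
  qed
  ultimately show "has_balanced_partition {..<n} E k d"
    unfolding has_balanced_partition_iff[OF graph] using y(2) by (intro exI[of _ x]) auto
qed

text \<open>All sinks together hold at least \<open>n\<close> vertices and the cover vertices fit
  where they are guessed, so the room they leave suffices for the rest.\<close>

lemma ex_feasible:
  assumes ok: "guess_ok \<alpha>"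
  shows "\<exists>y. transport.feasible {..<n} {..q} (sinks \<alpha>) sink_cap y"
proof -
  interpret transport "{..<n}" "{..q}" "sinks \<alpha>" "cut_cost \<alpha>" sink_cap
    using ok by (rule transport)
  have \<alpha>q: "\<alpha> u < q" if "u \<in> C" for u using ok that by (simp add: guess_ok_def)
  define l where "l i = card {u\<in>C. \<alpha> u = i}" for i
  have l0: "l q = 0" using \<alpha>q by (force simp: l_def)
  have l_le: "l i \<le> sink_cap i" if "i \<le> q" for i
  proof (cases "i = q")
    case False
    then show ?thesis using ok that by (simp add: guess_ok_def l_def sink_cap_def)
  qed (use l0 in simp)
  have "card C = (\<Sum>i\<le>q. l i)"
  proof -
    have "(\<Sum>i\<le>q. l i) = card (\<Union>i\<le>q. {u\<in>C. \<alpha> u = i})"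
      unfolding l_def by (subst card_UN_disjoint) auto
    also have "(\<Union>i\<le>q. {u\<in>C. \<alpha> u = i}) = C" using \<alpha>q by (auto simp: less_imp_le)
    finally show ?thesis by simp
  qed
  moreover have "n \<le> (\<Sum>i\<le>q. sink_cap i)"
  proof -
    have "(\<Sum>i\<le>q. sink_cap i) = (\<Sum>i<q. part_bound n d) + (d - q) * part_bound n d"
      by (simp add: lessThan_Suc_atMost[symmetric] sink_cap_def)
    also have "\<dots> = (q + (d - q)) * part_bound n d"
      by (simp add: algebra_simps)
    also have "\<dots> = part_bound n d * d"
      using q_le_d by simp
    finally show ?thesis using le_part_bound_mult[OF d, of n] by simp
  qed
  \<comment> \<open>Truncated subtraction is exact in every term because no sink is overfilled by
    cover vertices.\<close>
  moreover have "(\<Sum>i\<le>q. sink_cap i - l i) = (\<Sum>i\<le>q. sink_cap i) - (\<Sum>i\<le>q. l i)"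
    using l_le by (intro sum_subtractf_nat) auto
  moreover have "card ({..<n} - C) = n - card C"
    using C_sub by (simp add: card_Diff_subset)
  ultimately have "card ({..<n} - C) \<le> (\<Sum>i\<le>q. sink_cap i - l i)"
    by linarith
  then obtain g where g: "\<forall>v\<in>{..<n} - C. g v \<in> {..q}"
    "\<forall>i\<in>{..q}. card {v\<in>{..<n} - C. g v = i} \<le> sink_cap i - l i"
    using ex_bounded_distribution[of "{..q}" "{..<n} - C" "\<lambda>i. sink_cap i - l i"] by auto
  define y where "y v = (if v \<in> C then \<alpha> v else g v)" for v
  have "load y i \<le> sink_cap i" if "i \<le> q" for i
  proof -
    have eq: "{v\<in>{..<n}. y v = i} = {u\<in>C. \<alpha> u = i} \<union> {v\<in>{..<n} - C. g v = i}"
      using C_sub by (auto simp: y_def)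
    have "load y i \<le> l i + card {v\<in>{..<n} - C. g v = i}"
      unfolding load_def eq l_def by (rule card_Un_le)
    also have "\<dots> \<le> l i + (sink_cap i - l i)"
      using g(2) that by simp
    finally show ?thesis using l_le[OF that] by simp
  qed
  moreover have "\<forall>v<n. y v \<in> sinks \<alpha> v"
    using g(1) by (auto simp: y_def sinks_def)
  ultimately have "feasible y" by (auto simp: feasible_def)
  then show ?thesis by blast
qed

text \<open>With \<open>q + 1\<close> sinks and costs of at most \<open>card C\<close>, the price
  bound of the duality theorem becomes \<open>q * card C\<close>.\<close>

lemma balanced_iff_dual:
  assumes B: "q * card C < B"
  shows "has_balanced_partition {..<n} E k d \<longleftrightarrow>
    (\<exists>\<alpha>. guess_ok \<alpha> \<and> (\<forall>p. (\<forall>i\<le>q. p i < B) \<longrightarrow> dual \<alpha> p \<le> k + (\<Sum>i\<le>q. sink_cap i * p i)))"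
proof -
  have "(\<exists>y. transport.feasible {..<n} {..q} (sinks \<alpha>) sink_cap y \<and>
      transport.cost {..<n} (cut_cost \<alpha>) y \<le> k) \<longleftrightarrow>
    (\<forall>p. (\<forall>i\<le>q. p i < B) \<longrightarrow> dual \<alpha> p \<le> k + (\<Sum>i\<le>q. sink_cap i * p i))"
    if ok: "guess_ok \<alpha>" for \<alpha>
  proof -
    interpret transport "{..<n}" "{..q}" "sinks \<alpha>" "cut_cost \<alpha>" sink_cap
      using ok by (rule transport)
    have "cut_cost \<alpha> v i \<le> card C" for v i
      unfolding cut_cost_def by (intro card_mono) auto
    then show ?thesis
      using duality[OF ex_feasible[OF ok], of "card C" B k] B by (simp add: dual_def Ball_def)
  qed
  then show ?thesis unfolding balanced_iff_transport by blast
qed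

end

section \<open>Reasoning about programs\<close>

fun assigned :: "com \<Rightarrow> string set" where
  "assigned Skip = {}"
| "assigned (Write x a b) = {x}"
| "assigned (Seq c1 c2) = assigned c1 \<union> assigned c2"
| "assigned (Cond a c1 c2) = assigned c1 \<union> assigned c2"
| "assigned (While a c) = assigned c"

lemma exec_frame: "exec c s t s' \<Longrightarrow> y \<notin> assigned c \<Longrightarrow> s' y = s y"
  by (induction rule: exec.induct) auto

text \<open>The time is only an upper bound, so estimates can be rounded up wherever this simplifies
  them.\<close>

definition runs :: "com \<Rightarrow> state \<Rightarrow> nat \<Rightarrow> (state \<Rightarrow> bool) \<Rightarrow> bool" where
  "runs c s T Q \<longleftrightarrow> (\<exists>t s'. exec c s t s' \<and> t \<le> T \<and> Q s')"

text \<open>The frame condition is handed to the new postcondition, so that postconditions need not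
  list what a program leaves alone.\<close>

lemma runs_conseq:
  assumes "runs c s T Q" "T \<le> T'"
    and "\<And>s'. (\<And>y. y \<notin> assigned c \<Longrightarrow> s' y = s y) \<Longrightarrow> Q s' \<Longrightarrow> Q' s'"
  shows "runs c s T' Q'"
  using assms exec_frame unfolding runs_def by (meson order_trans)

lemma runs_Seq:
  assumes "runs c1 s T1 Q1"
    and "\<And>s'. (\<And>y. y \<notin> assigned c1 \<Longrightarrow> s' y = s y) \<Longrightarrow> Q1 s' \<Longrightarrow> runs c2 s' T2 Q"
  shows "runs (Seq c1 c2) s (T1 + T2) Q"
proof -
  obtain t1 s1 where 1: "exec c1 s t1 s1" "t1 \<le> T1" "Q1 s1"
    using assms(1) by (auto simp: runs_def)
  then obtain t2 s2 where 2: "exec c2 s1 t2 s2" "t2 \<le> T2" "Q s2"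
    using assms(2)[OF exec_frame[OF 1(1)]] by (auto simp: runs_def)
  show ?thesis
    unfolding runs_def using exec.Seq[OF 1(1) 2(1)] 1 2 by (meson add_mono)
qed

text \<open>Loop-free programs are run symbolically by the simplifier, without intermediate
  assertions.\<close>

fun straight :: "com \<Rightarrow> bool" where
  "straight (Seq c1 c2) \<longleftrightarrow> straight c1 \<and> straight c2"
| "straight (Cond a c1 c2) \<longleftrightarrow> straight c1 \<and> straight c2"
| "straight (While a c) \<longleftrightarrow> False"
| "straight _ \<longleftrightarrow> True"

fun effect :: "com \<Rightarrow> state \<Rightarrow> state" where
  "effect (Write x a b) s = s(x := (s x)(aval a s := aval b s))"
| "effect (Seq c1 c2) s = effect c2 (effect c1 s)"
| "effect (Cond a c1 c2) s = (if aval a s \<noteq> 0 then effect c1 s else effect c2 s)"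
| "effect _ s = s"

text \<open>A conditional is charged for both branches, which avoids maxima and makes the bound
  independent of the state.\<close>

fun duration :: "com \<Rightarrow> nat" where
  "duration Skip = 1"
| "duration (Write x a b) = 1 + acost a + acost b"
| "duration (Seq c1 c2) = duration c1 + duration c2"
| "duration (Cond a c1 c2) = 1 + acost a + (duration c1 + duration c2)"
| "duration (While a c) = 0"

lemma straight_exec: "straight c \<Longrightarrow> \<exists>t\<le>duration c. exec c s t (effect c s)"
proof (induction c arbitrary: s)
  case (Seq c1 c2)
  then show ?case by simp (meson add_mono exec.Seq)
next
  case (Cond a c1 c2)
  show ?case
  proof (cases "aval a s = 0")
    case True
    obtain t where "t \<le> duration c2" "exec c2 s t (effect c2 s)" using Cond by auto
    with True exec.CondFalse[OF True, of c2 t "effect c2 s" c1] show ?thesis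
      by (intro exI[of _ "1 + acost a + t"]) simp
  next
    case False
    obtain t where "t \<le> duration c1" "exec c1 s t (effect c1 s)" using Cond by auto
    with False exec.CondTrue[OF False, of c1 t "effect c1 s" c2] show ?thesis
      by (intro exI[of _ "1 + acost a + t"]) simp
  qed
next
  case Skip
  show ?case using exec.Skip by auto
next
  case (Write x a b)
  show ?case using exec.Write[of x a b s] by (intro exI[of _ "1 + acost a + acost b"]) (simp del: fun_upd_apply)
qed auto

lemma runs_straight: "straight c \<Longrightarrow> duration c \<le> T \<Longrightarrow> Q (effect c s) \<Longrightarrow> runs c s T Q"
  using straight_exec[of c s] unfolding runs_def by (meson order_trans)

abbreviation Var :: "string \<Rightarrow> aexp" where
  "Var x \<equiv> Read x (Const 0)"

abbreviation Assign :: "string \<Rightarrow> aexp \<Rightarrow> com" where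
  "Assign x e \<equiv> Write x (Const 0) e"

definition For :: "string \<Rightarrow> aexp \<Rightarrow> com \<Rightarrow> com" where
  "For x e c = Seq (Assign x (Const 0))
     (While (Sub e (Var x)) (Seq c (Assign x (Add (Var x) (Const 1)))))"

lemma assigned_For [simp]: "assigned (For x e c) = insert x (assigned c)"
  by (auto simp: For_def)

text \<open>The round number is a logical variable, and \<open>P\<close> has to tolerate any
  overwriting of the counter, because the counter is incremented after the body has established
  \<open>P\<close>. The bound expression is evaluated anew in each round, so its value must survive
  the body. Besides the body, a round takes \<open>acost e + 4\<close> steps for the test and 6 for
  the increment; the additional round in \<open>N + 1\<close> pays for the initialisation and the
  final test. The product form lets nested bounds multiply.\<close>

lemma runs_For:
  assumes P: "\<And>j s' w. P j s' \<Longrightarrow> P j (s'(x := w))"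
    and x: "x \<notin> assigned c"
    and e: "\<And>s'. (\<And>y. y \<noteq> x \<Longrightarrow> y \<notin> assigned c \<Longrightarrow> s' y = s y) \<Longrightarrow> aval e s' = N"
    and init: "P 0 s"
    and step: "\<And>j s'. j < N \<Longrightarrow> s' x 0 = j \<Longrightarrow>
      (\<And>y. y \<noteq> x \<Longrightarrow> y \<notin> assigned c \<Longrightarrow> s' y = s y) \<Longrightarrow> P j s' \<Longrightarrow> runs c s' T (P (Suc j))"
    and A: "N + 1 \<le> A" and B: "T + acost e + 10 \<le> B"
  shows "runs (For x e c) s (A * B) (P N)"
proof -
  let ?w = "While (Sub e (Var x)) (Seq c (Assign x (Add (Var x) (Const 1))))"
  have loop: "runs ?w s' ((N - j) * (T + acost e + 10) + acost e + 4) (P N)"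
    if "j \<le> N" "s' x 0 = j" "\<And>y. y \<noteq> x \<Longrightarrow> y \<notin> assigned c \<Longrightarrow> s' y = s y" "P j s'" for j s'
    using that
  proof (induction "N - j" arbitrary: j s')
    case 0
    have "aval e s' = N" by (rule e) (rule 0)
    then have "exec ?w s' (1 + acost (Sub e (Var x))) s'"
      using 0 by (intro exec.WhileFalse) simp
    then show ?case using 0 unfolding runs_def
      by (intro exI[of _ "1 + acost (Sub e (Var x))"] exI[of _ s']) simp
  next
    case (Suc k)
    have e': "aval e s' = N" by (rule e) (rule Suc)
    have j: "j < N" "k = N - Suc j" using Suc by auto
    obtain t1 s1 where 1: "exec c s' t1 s1" "t1 \<le> T" "P (Suc j) s1"
      using step[OF j(1) Suc(4,5,6)] by (auto simp: runs_def)
    define s2 where "s2 = s1(x := (s1 x)(0 := Suc j))"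
    have s1x: "s1 x 0 = j" using exec_frame[OF 1(1) x] Suc(4) by simp
    have body: "exec (Seq c (Assign x (Add (Var x) (Const 1)))) s' (t1 + 6) s2"
      using exec.Seq[OF 1(1) exec.Write[of x "Const 0" "Add (Var x) (Const 1)" s1]] s1x
      by (simp add: s2_def eval_nat_numeral)
    have "runs ?w s2 ((N - Suc j) * (T + acost e + 10) + acost e + 4) (P N)"
    proof (rule Suc.hyps(1)[OF j(2)])
      show "s2 y = s y" if "y \<noteq> x" "y \<notin> assigned c" for y
        using exec_frame[OF 1(1) that(2)] Suc(5)[OF that] that by (simp add: s2_def)
    qed (use j 1(3) P in \<open>auto simp: s2_def\<close>)
    then obtain t2 s3 where 2: "exec ?w s2 t2 s3"
      "t2 \<le> (N - Suc j) * (T + acost e + 10) + acost e + 4" "P N s3"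
      by (auto simp: runs_def)
    have "exec ?w s' (1 + acost (Sub e (Var x)) + (t1 + 6) + t2) s3"
      using exec.WhileTrue[OF _ body 2(1)] e' Suc(4) j by simp
    moreover have "N - j = Suc (N - Suc j)" using j(1) by simp
    then have "1 + acost (Sub e (Var x)) + (t1 + 6) + t2 \<le> (N - j) * (T + acost e + 10) + acost e + 4"
      using 1(2) 2(2) by simp
    ultimately show ?case using 2(3) unfolding runs_def by blast
  qed
  have "runs (For x e c) s (3 + (N * (T + acost e + 10) + acost e + 4)) (P N)"
    unfolding For_def
  proof (rule runs_Seq)
    show "runs (Assign x (Const 0)) s 3 (\<lambda>s'. P 0 s' \<and> s' x 0 = 0)"
      using P[OF init] by (intro runs_straight) auto
    show "runs ?w s' (N * (T + acost e + 10) + acost e + 4) (P N)"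
      if "\<And>y. y \<notin> assigned (Assign x (Const 0)) \<Longrightarrow> s' y = s y" "P 0 s' \<and> s' x 0 = 0" for s'
      using loop[of 0 s'] that by simp
  qed
  moreover have "3 + (N * (T + acost e + 10) + acost e + 4) \<le> A * B"
  proof -
    have "3 + (N * (T + acost e + 10) + acost e + 4) \<le> (N + 1) * (T + acost e + 10)"
      by simp
    also have "\<dots> \<le> A * B" using A B by (rule mult_le_mono)
    finally show ?thesis .
  qed
  ultimately show ?thesis by (rule runs_conseq)
qed

text \<open>Truth values are zero and nonzero; conjunction is the minimum of the two values.\<close>

definition And_Exp :: "aexp \<Rightarrow> aexp \<Rightarrow> aexp" where
  "And_Exp a b = Sub a (Sub a b)"

definition Or_Exp :: "aexp \<Rightarrow> aexp \<Rightarrow> aexp" where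
  "Or_Exp a b = Add a b"

definition Not_Exp :: "aexp \<Rightarrow> aexp" where
  "Not_Exp a = Sub (Const 1) a"

definition Less_Exp :: "aexp \<Rightarrow> aexp \<Rightarrow> aexp" where
  "Less_Exp a b = Sub b a"

definition Eq_Exp :: "aexp \<Rightarrow> aexp \<Rightarrow> aexp" where
  "Eq_Exp a b = Not_Exp (Add (Sub a b) (Sub b a))"

lemma aval_And [simp]: "0 < aval (And_Exp a b) s \<longleftrightarrow> 0 < aval a s \<and> 0 < aval b s"
  by (auto simp: And_Exp_def)

lemma aval_Or [simp]: "0 < aval (Or_Exp a b) s \<longleftrightarrow> 0 < aval a s \<or> 0 < aval b s"
  by (auto simp: Or_Exp_def)

lemma aval_Not [simp]: "0 < aval (Not_Exp a) s \<longleftrightarrow> aval a s = 0"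
  by (auto simp: Not_Exp_def)

lemma aval_Less [simp]: "0 < aval (Less_Exp a b) s \<longleftrightarrow> aval a s < aval b s"
  by (auto simp: Less_Exp_def)

lemma aval_Eq [simp]: "aval (Eq_Exp a b) s = of_bool (aval a s = aval b s)"
  by (auto simp: Eq_Exp_def Not_Exp_def)

lemmas acost_defs = And_Exp_def Or_Exp_def Not_Exp_def Less_Exp_def Eq_Exp_def

text \<open>The accumulator is not reset. A summand 1 makes this a counter, and a guard that always
  holds makes it a multiplication by repeated addition.\<close>

definition Sum_If :: "string \<Rightarrow> aexp \<Rightarrow> aexp \<Rightarrow> aexp \<Rightarrow> string \<Rightarrow> com" where
  "Sum_If x e g w acc = For x e (Cond g (Assign acc (Add (Var acc) w)) Skip)"

lemma assigned_Sum_If [simp]: "assigned (Sum_If x e g w acc) = {x, acc}"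
  by (auto simp: Sum_If_def)

lemma runs_Sum_If:
  assumes "x \<noteq> acc"
    and e: "\<And>s'. (\<And>y. y \<noteq> x \<Longrightarrow> y \<noteq> acc \<Longrightarrow> s' y = s y) \<Longrightarrow> aval e s' = N"
    and g: "\<And>s' j. j < N \<Longrightarrow> s' x 0 = j \<Longrightarrow> (\<And>y. y \<noteq> x \<Longrightarrow> y \<noteq> acc \<Longrightarrow> s' y = s y) \<Longrightarrow>
      0 < aval g s' \<longleftrightarrow> G j"
    and w: "\<And>s' j. j < N \<Longrightarrow> s' x 0 = j \<Longrightarrow> (\<And>y. y \<noteq> x \<Longrightarrow> y \<noteq> acc \<Longrightarrow> s' y = s y) \<Longrightarrow>
      G j \<Longrightarrow> aval w s' = W j"
    and A: "N + 1 \<le> A" and B: "acost g + acost w + acost e + 20 \<le> B"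
  shows "runs (Sum_If x e g w acc) s (A * B)
    (\<lambda>s'. s' acc 0 = s acc 0 + (\<Sum>j<N. if G j then W j else 0))"
  unfolding Sum_If_def
proof (rule runs_For[where T = "acost g + acost w + 10" and
      P = "\<lambda>j s'. s' acc 0 = s acc 0 + (\<Sum>j<j. if G j then W j else 0)"])
  show "runs (Cond g (Assign acc (Add (Var acc) w)) Skip) s' (acost g + acost w + 10)
      (\<lambda>s'. s' acc 0 = s acc 0 + (\<Sum>j<Suc j. if G j then W j else 0))"
    if "j < N" "s' x 0 = j" "s' acc 0 = s acc 0 + (\<Sum>j<j. if G j then W j else 0)"
      "\<And>y. y \<noteq> x \<Longrightarrow> y \<notin> assigned (Cond g (Assign acc (Add (Var acc) w)) Skip) \<Longrightarrow> s' y = s y" for s' j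
    using that g[of j s'] w[of j s'] by (intro runs_straight) auto
qed (use assms in auto)

definition Pow2 :: "string \<Rightarrow> aexp \<Rightarrow> com" where
  "Pow2 x e = Seq (Assign x (Const 1)) (For ''t'' e (Assign x (Add (Var x) (Var x))))"

lemma assigned_Pow2 [simp]: "assigned (Pow2 x e) = {''t'', x}"
  by (auto simp: Pow2_def)

lemma runs_Pow2:
  assumes x: "x \<noteq> ''t''"
    and e: "\<And>s'. (\<And>y. y \<noteq> ''t'' \<Longrightarrow> y \<noteq> x \<Longrightarrow> s' y = s y) \<Longrightarrow> aval e s' = N"
    and A: "N + 1 \<le> A"
  shows "runs (Pow2 x e) s (A * (acost e + 30)) (\<lambda>s'. s' x 0 = 2 ^ N)"
proof (rule runs_conseq)
  show "runs (Pow2 x e) s (3 + (N + 1) * (acost e + 20)) (\<lambda>s'. s' x 0 = 2 ^ N)"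
    unfolding Pow2_def
  proof (rule runs_Seq)
    show "runs (Assign x (Const 1)) s 3 (\<lambda>s'. s' x 0 = 1)"
      by (intro runs_straight) auto
    show "runs (For ''t'' e (Assign x (Add (Var x) (Var x)))) s' ((N + 1) * (acost e + 20))
        (\<lambda>s'. s' x 0 = 2 ^ N)"
      if s': "\<And>y. y \<notin> assigned (Assign x (Const 1)) \<Longrightarrow> s' y = s y" "s' x 0 = 1" for s'
    proof (rule runs_For[where P = "\<lambda>j s'. s' x 0 = 2 ^ j" and T = 8])
      show "runs (Assign x (Add (Var x) (Var x))) s'' 8 (\<lambda>s'. s' x 0 = 2 ^ Suc j)"
        if "s'' x 0 = 2 ^ j" for s'' j
        using that by (intro runs_straight) auto
      show "aval e s'' = N"
        if "\<And>y. y \<noteq> ''t'' \<Longrightarrow> y \<notin> assigned (Assign x (Add (Var x) (Var x))) \<Longrightarrow> s'' y = s' y" for s''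
        using that s'(1) by (intro e) auto
    qed (use x s' in auto)
  qed
  have "3 + (N + 1) * (acost e + 20) \<le> (N + 1) * (acost e + 30)"
    by (simp add: algebra_simps)
  also have "\<dots> \<le> A * (acost e + 30)" using A by (rule mult_le_mono1)
  finally show "3 + (N + 1) * (acost e + 20) \<le> A * (acost e + 30)" .
qed

text \<open>
  Division is repeated subtraction. It is run \<open>h\<close> times, where \<open>h\<close> bounds the decoded number, so
  that bounded loops suffice throughout.
\<close>

definition Decode :: "string \<Rightarrow> string \<Rightarrow> aexp \<Rightarrow> aexp \<Rightarrow> com" where
  "Decode x src b l = Seq (Assign ''rem'' (Var src))
    (For ''i'' l
      (Seq (Assign ''quo'' (Const 0))
      (Seq (For ''t'' (Var ''h'')
        (Cond (Less_Exp b (Add (Var ''rem'') (Const 1)))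
          (Seq (Assign ''rem'' (Sub (Var ''rem'') b)) (Assign ''quo'' (Add (Var ''quo'') (Const 1))))
          Skip))
      (Seq (Write x (Var ''i'') (Var ''rem'')) (Assign ''rem'' (Var ''quo''))))))"

lemma assigned_Decode [simp]: "assigned (Decode x src b l) = {''rem'', ''i'', ''quo'', ''t'', x}"
  by (auto simp: Decode_def)

text \<open>Positivity of the base is conditional because an empty cover gives \<open>q = 0\<close>,
  and then no digit of a guess is requested.\<close>

lemma runs_Decode:
  assumes x: "x \<notin> {''rem'', ''i'', ''quo'', ''t'', ''h''}"
    and b: "\<And>s'. (\<And>y. y \<notin> {''rem'', ''i'', ''quo'', ''t'', x} \<Longrightarrow> s' y = s y) \<Longrightarrow> aval b s' = b'"
    and l: "\<And>s'. (\<And>y. y \<notin> {''rem'', ''i'', ''quo'', ''t'', x} \<Longrightarrow> s' y = s y) \<Longrightarrow> aval l s' = l'"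
    and b': "l' > 0 \<Longrightarrow> b' > 0"
    and src: "s src 0 = N" and N: "N \<le> s ''h'' 0"
    and h: "s ''h'' 0 + 1 \<le> h'"
    and A: "l' + 1 \<le> A" and B: "h' * (3 * acost b + 60) + acost l + 30 \<le> B"
  shows "runs (Decode x src b l) s (5 + A * B) (\<lambda>s'. \<forall>j<l'. s' x j = N div b' ^ j mod b')"
  unfolding Decode_def
proof (rule runs_Seq)
  let ?inner = "Cond (Less_Exp b (Add (Var ''rem'') (Const 1)))
          (Seq (Assign ''rem'' (Sub (Var ''rem'') b)) (Assign ''quo'' (Add (Var ''quo'') (Const 1))))
          Skip"
  let ?body = "Seq (Assign ''quo'' (Const 0))
      (Seq (For ''t'' (Var ''h'') ?inner)
      (Seq (Write x (Var ''i'') (Var ''rem'')) (Assign ''rem'' (Var ''quo''))))"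
  show "runs (Assign ''rem'' (Var src)) s 5 (\<lambda>s'. s' ''rem'' 0 = N)"
    using src by (intro runs_straight) auto
  fix s1 assume s1: "\<And>y. y \<notin> assigned (Assign ''rem'' (Var src)) \<Longrightarrow> s1 y = s y" "s1 ''rem'' 0 = N"
  show "runs (For ''i'' l ?body) s1 (A * B) (\<lambda>s'. \<forall>j<l'. s' x j = N div b' ^ j mod b')"
  proof (rule runs_conseq)
    show "runs (For ''i'' l ?body) s1 (A * B)
      (\<lambda>s'. s' ''rem'' 0 = N div b' ^ l' \<and> (\<forall>j<l'. s' x j = N div b' ^ j mod b'))"
    proof (rule runs_For[where T = "3 + (h' * (3 * acost b + 60) + 10)" and
        P = "\<lambda>i s'. s' ''rem'' 0 = N div b' ^ i \<and> (\<forall>j<i. s' x j = N div b' ^ j mod b')"])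
      show "aval l s' = l'"
        if "\<And>y. y \<noteq> ''i'' \<Longrightarrow> y \<notin> assigned ?body \<Longrightarrow> s' y = s1 y" for s'
        using that s1(1) by (intro l) auto
      fix i s2
      assume i: "i < l'" "s2 ''i'' 0 = i"
        and s2: "\<And>y. y \<noteq> ''i'' \<Longrightarrow> y \<notin> assigned ?body \<Longrightarrow> s2 y = s1 y"
        and P: "s2 ''rem'' 0 = N div b' ^ i \<and> (\<forall>j<i. s2 x j = N div b' ^ j mod b')"
      have agree: "s2 y = s y" if "y \<notin> {''rem'', ''i'', ''quo'', ''t'', x}" for y
        using that s1(1) s2 by simp
      define r where "r = N div b' ^ i"
      have b'0: "b' > 0" using i b' by simp
      have r: "r div b' \<le> s ''h'' 0"
        using div_le_dividend[of r b'] div_le_dividend[of N "b' ^ i"] N unfolding r_def by linarith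
      show "runs ?body s2 (3 + (h' * (3 * acost b + 60) + 10))
         (\<lambda>s'. s' ''rem'' 0 = N div b' ^ Suc i \<and> (\<forall>j<Suc i. s' x j = N div b' ^ j mod b'))"
      proof (rule runs_Seq)
        show "runs (Assign ''quo'' (Const 0)) s2 3 (\<lambda>s'. s' ''quo'' 0 = 0)"
          by (intro runs_straight) auto
        fix s3 assume s3: "\<And>y. y \<notin> assigned (Assign ''quo'' (Const 0)) \<Longrightarrow> s3 y = s2 y" "s3 ''quo'' 0 = 0"
        show "runs (Seq (For ''t'' (Var ''h'') ?inner)
            (Seq (Write x (Var ''i'') (Var ''rem'')) (Assign ''rem'' (Var ''quo''))))
            s3 (h' * (3 * acost b + 60) + 10)
          (\<lambda>s'. s' ''rem'' 0 = N div b' ^ Suc i \<and> (\<forall>j<Suc i. s' x j = N div b' ^ j mod b'))"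
        proof (rule runs_Seq)
          show "runs (For ''t'' (Var ''h'') ?inner) s3 (h' * (3 * acost b + 60))
            (\<lambda>s'. s' ''rem'' 0 + b' * s' ''quo'' 0 = r \<and> s' ''quo'' 0 = min (s ''h'' 0) (r div b'))"
          \<comment> \<open>Once the remainder is below the base, further rounds do nothing and the
            count stays at \<open>r div b'\<close>. As \<open>h\<close> is at least this quotient,
            the division is complete after \<open>h\<close> rounds.\<close>
          proof (rule runs_For[where T = "3 * acost b + 40" and
              P = "\<lambda>t s'. s' ''rem'' 0 + b' * s' ''quo'' 0 = r \<and> s' ''quo'' 0 = min t (r div b')"])
            fix t s4
            assume s4: "\<And>y. y \<noteq> ''t'' \<Longrightarrow> y \<notin> assigned ?inner \<Longrightarrow> s4 y = s3 y"
              and P4: "s4 ''rem'' 0 + b' * s4 ''quo'' 0 = r \<and> s4 ''quo'' 0 = min t (r div b')"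
            define rem quo where "rem = s4 ''rem'' 0" and "quo = s4 ''quo'' 0"
            have aval_b: "aval b s' = b'" if "\<And>y. y \<noteq> ''rem'' \<Longrightarrow> s' y = s4 y" for s'
              by (rule b) (use x that s4 s3 agree in auto)
            have rq: "rem + b' * quo = r" "quo = min t (r div b')"
              using P4 by (auto simp: rem_def quo_def)
            have "b' \<le> rem \<longleftrightarrow> quo < r div b'"
            proof -
              have "r div b' = rem div b' + quo"
                using rq(1) b'0 by (simp flip: rq(1))
              then show ?thesis using b'0 by (simp add: div_greater_zero_iff)
            qed
            then have "(b' \<le> rem \<longrightarrow> Suc quo = min (Suc t) (r div b')) \<and>
              (\<not> b' \<le> rem \<longrightarrow> quo = min (Suc t) (r div b'))"
              using rq(2) by linarith
            moreover have "b' \<le> rem \<longrightarrow> rem - b' + b' * Suc quo = r"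
              using rq(1) by simp
            ultimately show "runs ?inner s4 (3 * acost b + 40)
              (\<lambda>s'. s' ''rem'' 0 + b' * s' ''quo'' 0 = r \<and> s' ''quo'' 0 = min (Suc t) (r div b'))"
              using aval_b[of s4] rq(1)
              by (intro runs_straight) (auto simp: Less_Exp_def less_Suc_eq_le rem_def quo_def)
          next
            show "aval (Var ''h'') s' = s ''h'' 0"
              if "\<And>y. y \<noteq> ''t'' \<Longrightarrow> y \<notin> assigned ?inner \<Longrightarrow> s' y = s3 y" for s'
              using that[of "''h''"] s3(1)[of "''h''"] agree[of "''h''"] x by auto
            show "s3 ''rem'' 0 + b' * s3 ''quo'' 0 = r \<and> s3 ''quo'' 0 = min 0 (r div b')"
              using s3(1)[of "''rem''"] s3(2) P by (simp add: r_def)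
          qed (use h in auto)
          fix s4
          assume s4: "\<And>y. y \<notin> assigned (For ''t'' (Var ''h'') ?inner) \<Longrightarrow> s4 y = s3 y"
            and P4: "s4 ''rem'' 0 + b' * s4 ''quo'' 0 = r \<and> s4 ''quo'' 0 = min (s ''h'' 0) (r div b')"
          have quo: "s4 ''quo'' 0 = r div b'" using P4 r by simp
          then have rem: "s4 ''rem'' 0 = r mod b'"
            using P4 by (metis add_right_cancel mod_mult_div_eq)
          have s4i: "s4 ''i'' 0 = i" using s4[of "''i''"] s3(1)[of "''i''"] i by simp
          have s4x: "s4 x = s2 x" using s4[of x] s3(1)[of x] x by simp
          show "runs (Seq (Write x (Var ''i'') (Var ''rem'')) (Assign ''rem'' (Var ''quo''))) s4 10
            (\<lambda>s'. s' ''rem'' 0 = N div b' ^ Suc i \<and> (\<forall>j<Suc i. s' x j = N div b' ^ j mod b'))"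
            using x P quo rem s4i s4x
            by (intro runs_straight)
              (auto simp: r_def div_mult2_eq less_Suc_eq mult.commute[of b'])
        qed
      qed
    qed (use x s1 A B in auto)
  qed auto
qed

text \<open>Horner's scheme. It makes the enumeration complete: every vector of digits is decoded
  from some number below \<open>b ^ l\<close>.\<close>

lemma ex_digits:
  assumes "\<forall>i<l. a i < b"
  shows "\<exists>N<b ^ l. \<forall>i<l. N div b ^ i mod b = (a i :: nat)"
  using assms
proof (induction l arbitrary: a)
  case 0
  then show ?case by simp
next
  case (Suc l)
  have "\<forall>i<l. a (Suc i) < b" using Suc.prems by simp
  from Suc.IH[OF this] obtain N where N: "N < b ^ l" "\<forall>i<l. N div b ^ i mod b = a (Suc i)"
    by blast
  have a0: "a 0 < b" using Suc.prems by simp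
  define M where "M = a 0 + b * N"
  have "M < b * Suc N" using a0 by (simp add: M_def)
  also have "\<dots> \<le> b * b ^ l" using N(1) by (intro mult_le_mono2) simp
  finally have "M < b ^ Suc l" by simp
  moreover have "M div b ^ i mod b = a i" if "i < Suc l" for i
  proof (cases i)
    case 0
    then show ?thesis using a0 by (simp add: M_def)
  next
    case (Suc j)
    have "M div b = N" using a0 by (simp add: M_def)
    then have "M div b ^ i = N div b ^ j" by (simp add: Suc div_mult2_eq)
    then show ?thesis using N(2) that Suc by simp
  qed
  ultimately show ?case by blast
qed

section \<open>Searching through guesses and prices\<close>

abbreviation "adj_exp v u \<equiv> Read ''in'' (Add (Read ''row'' v) u)"

abbreviation "part_exp v \<equiv> Read ''a'' (Read ''pos'' v)"

definition Check :: com where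
  "Check = For ''i'' (Var ''q'')
     (Seq (Assign ''cnt'' (Const 0))
     (Seq (Sum_If ''u'' (Var ''in'')
        (And_Exp (Read ''cv'' (Var ''u'')) (Eq_Exp (part_exp (Var ''u'')) (Var ''i''))) (Const 1) ''cnt'')
     (Cond (Less_Exp (Var ''cap'') (Var ''cnt'')) (Assign ''ok'' (Const 0)) Skip)))"

text \<open>Capacity times price is formed by adding the capacity once per unit of price. The price
  has to drive the loop: it is bounded in terms of the cover, whereas the capacity of the pooled
  sink grows with the binary number \<open>d\<close>.\<close>

definition Price :: com where
  "Price = Seq (Assign ''rhs'' (Read ''in'' (Const 1)))
     (For ''i'' (Add (Var ''q'') (Const 1))
       (Sum_If ''t'' (Read ''p'' (Var ''i'')) (Const 1) (Read ''cp'' (Var ''i'')) ''rhs''))"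

text \<open>
  The initial value \<open>e + n\<close> of \<open>best\<close> exceeds every candidate, as prices are below \<open>e\<close> and cut
  costs at most \<open>n\<close>.
\<close>

definition Best_Sink :: com where
  "Best_Sink = For ''i'' (Add (Var ''q'') (Const 1))
     (Seq (Assign ''s'' (Read ''p'' (Var ''i'')))
     (Seq (Sum_If ''u'' (Var ''in'')
        (And_Exp (adj_exp (Var ''v'') (Var ''u'')) (And_Exp (Read ''cv'' (Var ''u''))
          (And_Exp (Not_Exp (Eq_Exp (part_exp (Var ''u'')) (Var ''i'')))
            (Or_Exp (Not_Exp (Read ''cv'' (Var ''v''))) (Less_Exp (Var ''u'') (Var ''v''))))))
        (Const 1) ''s'')
     (Cond (And_Exp (Or_Exp (Not_Exp (Read ''cv'' (Var ''v''))) (Eq_Exp (part_exp (Var ''v'')) (Var ''i'')))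
        (Less_Exp (Var ''s'') (Var ''best''))) (Assign ''best'' (Var ''s'')) Skip)))"

definition Dual :: com where
  "Dual = Seq (Assign ''lhs'' (Const 0))
     (For ''v'' (Var ''in'')
       (Seq (Assign ''best'' (Add (Var ''e'') (Var ''in'')))
       (Seq Best_Sink
       (Assign ''lhs'' (Add (Var ''lhs'') (Var ''best''))))))"

definition Test_Prices :: com where
  "Test_Prices = For ''x2'' (Var ''h'')
     (Seq (Decode ''p'' ''x2'' (Var ''e'') (Add (Var ''q'') (Const 1)))
     (Seq Price
     (Seq Dual
     (Cond (Less_Exp (Var ''rhs'') (Var ''lhs'')) (Assign ''ok'' (Const 0)) Skip))))"

text \<open>
  Both enumerations run up to the same bound \<open>h\<close>, which is at least the number of guesses and of price
  vectors; superfluous numbers merely repeat guesses or prices.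
\<close>

definition Search :: com where
  "Search = For ''x1'' (Var ''h'')
     (Seq (Decode ''a'' ''x1'' (Var ''q'') (Var ''m''))
     (Seq (Assign ''ok'' (Const 1))
     (Seq Check
     (Seq Test_Prices
     (Cond (Var ''ok'') (Assign ''out'' (Const 1)) Skip)))))"

lemma assigned_Check [simp]: "assigned Check = {''i'', ''cnt'', ''u'', ''ok''}"
  by (auto simp: Check_def)

lemma assigned_Price [simp]: "assigned Price = {''rhs'', ''i'', ''t''}"
  by (auto simp: Price_def)

lemma assigned_Best_Sink [simp]: "assigned Best_Sink = {''i'', ''s'', ''u'', ''best''}"
  by (auto simp: Best_Sink_def)

lemma assigned_Dual [simp]: "assigned Dual = {''lhs'', ''v'', ''best'', ''i'', ''s'', ''u''}"
  by (auto simp: Dual_def)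

lemma assigned_Test_Prices [simp]: "assigned Test_Prices =
  {''x2'', ''rem'', ''i'', ''quo'', ''t'', ''p'', ''rhs'', ''lhs'', ''v'', ''best'', ''s'', ''u'', ''ok''}"
  by (auto simp: Test_Prices_def)

lemma sum_if_one: "(\<Sum>j<N. if G j then 1 else 0) = card {j \<in> {..<N::nat}. G j}"
  by (simp add: sum.If_cases Int_def)

definition digit :: "nat \<Rightarrow> nat \<Rightarrow> nat \<Rightarrow> nat" where
  "digit b N j = N div b ^ j mod b"

text \<open>The interface between preparation and search: \<open>g\<close> is the memory when the
  search starts. The injection \<open>pos\<close> assigns to each cover vertex its digit of the
  guess.\<close>

locale loaded_graph = covered_graph n E k d C for n E k d C +
  fixes g :: state
  assumes input: "g ''in'' 0 = n" "g ''in'' (Suc 0) = k" "g ''in'' 2 = d"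
    and adj: "\<And>u v. u < n \<Longrightarrow> v < n \<Longrightarrow> g ''in'' (g ''row'' v + u) = of_bool ({v, u} \<in> E)"
    and cv: "\<And>v. v < n \<Longrightarrow> g ''cv'' v = of_bool (v \<in> C)"
    and pos_inj: "inj_on (g ''pos'') C" and pos_less: "\<And>u. u \<in> C \<Longrightarrow> g ''pos'' u < card C"
    and params: "g ''m'' 0 = card C" "g ''q'' 0 = q" "g ''cap'' 0 = part_bound n d"
    and cp: "\<And>i. i \<le> q \<Longrightarrow> g ''cp'' i = sink_cap i"
    and e: "g ''e'' 0 = 2 ^ (card C + 3)" and h: "g ''h'' 0 = 2 ^ g ''e'' 0"
begin

text \<open>The listed arrays are read-only during the search, so its parts are verified for every
  state that agrees with \<open>g\<close> on them.\<close>

definition agree :: "state \<Rightarrow> bool" where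
  "agree s \<longleftrightarrow> (\<forall>y\<in>{''in'', ''row'', ''cv'', ''pos'', ''m'', ''q'', ''cap'', ''cp'', ''e'', ''h''}. s y = g y)"

lemma agree_simps:
  assumes "agree s"
  shows "s ''in'' = g ''in''" "s ''row'' = g ''row''" "s ''cv'' = g ''cv''" "s ''pos'' = g ''pos''"
    "s ''m'' = g ''m''" "s ''q'' = g ''q''" "s ''cap'' = g ''cap''" "s ''cp'' = g ''cp''"
    "s ''e'' = g ''e''" "s ''h'' = g ''h''"
  using assms by (auto simp: agree_def)

text \<open>Exceeds the number of rounds of every loop over vertices, cover vertices or sinks. The 4
  also leaves room for the \<open>card C + 3\<close> doublings that compute \<open>e\<close>, and
  \<open>n + 4\<close> is still a lower bound for the input size.\<close>

abbreviation "R \<equiv> n + 4"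
abbreviation "e\<^sub>0 \<equiv> g ''e'' 0"
abbreviation "h\<^sub>0 \<equiv> g ''h'' 0"

lemma card_C_le: "card C \<le> n"
  using card_mono[OF _ C_sub] by simp

lemma q_le_n: "q \<le> n"
  using card_C_le q_le_card by simp

lemma e_le_h: "e\<^sub>0 < h\<^sub>0" by (simp add: h)

text \<open>The smallest value belongs to the empty cover, where \<open>e\<close> is 8. The bound
  lets additive constants be absorbed into multiples of \<open>h\<close>.\<close>

lemma h_ge: "256 \<le> h\<^sub>0"
proof -
  have "(2::nat) ^ 3 \<le> 2 ^ (card C + 3)" by (rule power_increasing) auto
  then have "(2::nat) ^ 8 \<le> 2 ^ e\<^sub>0" by (intro power_increasing) (auto simp: e)
  then show ?thesis by (simp add: h)
qed

section \<open>Correctness and running time of the search\<close>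

lemma runs_Check:
  assumes s: "agree s" and a: "\<forall>u\<in>C. s ''a'' (g ''pos'' u) = \<alpha> u" and \<alpha>: "\<forall>u\<in>C. \<alpha> u < q"
  shows "runs Check s (R * (R * 100)) (\<lambda>s'. s' ''ok'' 0 = (if guess_ok \<alpha> then s ''ok'' 0 else 0))"
proof -
  have guess: "guess_ok \<alpha> \<longleftrightarrow> (\<forall>i<q. card {u\<in>C. \<alpha> u = i} \<le> part_bound n d)"
    using \<alpha> by (simp add: guess_ok_def)
  show ?thesis
    unfolding Check_def guess
  proof (rule runs_For[where T = "3 + (R * 60 + 30)" and N = q and
      P = "\<lambda>i s'. s' ''ok'' 0 = (if \<forall>j<i. card {u\<in>C. \<alpha> u = j} \<le> part_bound n d then s ''ok'' 0 else 0)"],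
      goal_cases)
    case (5 i s1)
    have s1: "agree s1" using s 5(3) by (simp add: agree_def)
    have a1: "s1 ''a'' = s ''a''" using 5(3) by simp
    show ?case
    proof (rule runs_Seq)
      show "runs (Assign ''cnt'' (Const 0)) s1 3 (\<lambda>s'. s' ''cnt'' 0 = 0)"
        by (intro runs_straight) auto
      fix s2 assume s2: "\<And>y. y \<notin> assigned (Assign ''cnt'' (Const 0)) \<Longrightarrow> s2 y = s1 y" "s2 ''cnt'' 0 = 0"
      have ag2: "agree s2" using s1 s2(1) by (simp add: agree_def)
      have a2: "s2 ''a'' = s ''a''" "s2 ''i'' 0 = i" "s2 ''ok'' = s1 ''ok''"
        using a1 s2(1) 5(2) by simp_all
      show "runs (Seq (Sum_If ''u'' (Var ''in'')
        (And_Exp (Read ''cv'' (Var ''u'')) (Eq_Exp (part_exp (Var ''u'')) (Var ''i''))) (Const 1) ''cnt'')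
        (Cond (Less_Exp (Var ''cap'') (Var ''cnt'')) (Assign ''ok'' (Const 0)) Skip)) s2 (R * 60 + 30)
        (\<lambda>s'. s' ''ok'' 0 = (if \<forall>j<Suc i. card {u\<in>C. \<alpha> u = j} \<le> part_bound n d then s ''ok'' 0 else 0))"
      proof (rule runs_Seq)
        show "runs (Sum_If ''u'' (Var ''in'')
          (And_Exp (Read ''cv'' (Var ''u'')) (Eq_Exp (part_exp (Var ''u'')) (Var ''i''))) (Const 1) ''cnt'') s2 (R * 60)
          (\<lambda>s'. s' ''cnt'' 0 = s2 ''cnt'' 0 + (\<Sum>u<n. if u \<in> C \<and> \<alpha> u = i then 1 else 0))"
        proof (rule runs_Sum_If, goal_cases)
          case (3 s3 u)
          have "agree s3" using ag2 3(3) by (simp add: agree_def)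
          moreover have "s3 ''a'' = s ''a''" "s3 ''i'' 0 = i" using 3(3) a2 by simp_all
          ultimately show ?case using 3(1,2) a by (auto simp: agree_simps cv)
        next
          case (2 s3)
          then show ?case using ag2 by (simp add: agree_simps input)
        qed (auto simp: acost_defs)
        fix s3
        assume s3: "\<And>y. y \<notin> assigned (Sum_If ''u'' (Var ''in'')
          (And_Exp (Read ''cv'' (Var ''u'')) (Eq_Exp (part_exp (Var ''u'')) (Var ''i''))) (Const 1) ''cnt'') \<Longrightarrow> s3 y = s2 y"
          "s3 ''cnt'' 0 = s2 ''cnt'' 0 + (\<Sum>u<n. if u \<in> C \<and> \<alpha> u = i then 1 else 0)"
        have ag3: "agree s3" using ag2 s3(1) by (simp add: agree_def)
        have "{u\<in>{..<n}. u \<in> C \<and> \<alpha> u = i} = {u\<in>C. \<alpha> u = i}" using C_sub by auto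
        then have cnt: "s3 ''cnt'' 0 = card {u\<in>C. \<alpha> u = i}"
          using s3(2) s2(2) by (simp add: sum_if_one)
        have ok: "s3 ''ok'' = s1 ''ok''" using s3(1) a2 by simp
        show "runs (Cond (Less_Exp (Var ''cap'') (Var ''cnt'')) (Assign ''ok'' (Const 0)) Skip) s3 30
          (\<lambda>s'. s' ''ok'' 0 = (if \<forall>j<Suc i. card {u\<in>C. \<alpha> u = j} \<le> part_bound n d then s ''ok'' 0 else 0))"
          using cnt ok ag3 5(4)
          by (intro runs_straight) (auto simp: agree_simps params less_Suc_eq acost_defs)
      qed
    qed
  qed (use s q_le_n in \<open>auto simp: agree_simps params\<close>)
qed

lemma runs_Price:
  assumes s: "agree s" and p: "\<forall>i\<le>q. s ''p'' i = p i \<and> p i < e\<^sub>0"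
  shows "runs Price s (4 + R * (h\<^sub>0 * 60)) (\<lambda>s'. s' ''rhs'' 0 = k + (\<Sum>i\<le>q. sink_cap i * p i))"
  unfolding Price_def
proof (rule runs_Seq)
  show "runs (Assign ''rhs'' (Read ''in'' (Const 1))) s 4 (\<lambda>s'. s' ''rhs'' 0 = k)"
    using s by (intro runs_straight) (auto simp: agree_simps input)
  fix s1 assume s1: "\<And>y. y \<notin> assigned (Assign ''rhs'' (Read ''in'' (Const 1))) \<Longrightarrow> s1 y = s y" "s1 ''rhs'' 0 = k"
  have ag1: "agree s1" using s s1(1) by (simp add: agree_def)
  have p1: "s1 ''p'' = s ''p''" using s1(1) by simp
  let ?body = "Sum_If ''t'' (Read ''p'' (Var ''i'')) (Const 1) (Read ''cp'' (Var ''i'')) ''rhs''"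
  have "runs (For ''i'' (Add (Var ''q'') (Const 1)) ?body) s1 (R * (h\<^sub>0 * 60))
    (\<lambda>s'. s' ''rhs'' 0 = k + (\<Sum>i<Suc q. sink_cap i * p i))"
  proof (rule runs_For[where T = "h\<^sub>0 * 40" and N = "Suc q" and
        P = "\<lambda>i s'. s' ''rhs'' 0 = k + (\<Sum>j<i. sink_cap j * p j)"], goal_cases)
    case (5 i s2)
    have ag2: "agree s2" using ag1 5(3) by (simp add: agree_def)
    have p2: "s2 ''p'' = s ''p''" using 5(3) p1 by simp
    have i: "i \<le> q" using 5 by simp
    show ?case
    proof (rule runs_conseq)
      show "runs ?body s2 (h\<^sub>0 * 40) (\<lambda>s'. s' ''rhs'' 0 = s2 ''rhs'' 0 + (\<Sum>j<p i. if True then sink_cap i else 0))"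
      proof (rule runs_Sum_If, goal_cases)
        case (2 s3)
        then have "s3 ''p'' = s ''p''" "s3 ''i'' 0 = i" using p2 5(2) by simp_all
        then show ?case using p i by simp
      next
        case (4 s3 j)
        have "agree s3" using ag2 4(3) by (simp add: agree_def)
        moreover have "s3 ''i'' 0 = i" using 4(3) 5(2) by simp
        ultimately show ?case using i by (simp add: agree_simps cp)
      next
        case 5
        then show ?case using p i e_le_h by auto
      qed auto
    qed (use 5(4) in \<open>auto simp: mult.commute\<close>)
  next
    case 7
    then show ?case using h_ge by simp
  qed (use ag1 s1(2) q_le_n in \<open>auto simp: agree_simps params\<close>)
  then show "runs (For ''i'' (Add (Var ''q'') (Const 1)) ?body) s1 (R * (h\<^sub>0 * 60))
    (\<lambda>s'. s' ''rhs'' 0 = k + (\<Sum>i\<le>q. sink_cap i * p i))"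
    by (simp add: lessThan_Suc_atMost)
qed

lemma cut_cost_le: "cut_cost \<alpha> v i \<le> n"
  using card_mono[OF fin_C, of "{u \<in> C. {v, u} \<in> E \<and> \<alpha> u \<noteq> i \<and> (v \<in> C \<longrightarrow> u < v)}"] card_C_le
  unfolding cut_cost_def by fastforce

text \<open>The start value remains in the invariant as an extra candidate, which keeps the set
  under \<open>Min\<close> nonempty before an admissible sink is met. It drops out at the end
  because admissible candidates do not exceed it.\<close>

lemma runs_Best_Sink:
  assumes s: "agree s" and a: "\<forall>u\<in>C. s ''a'' (g ''pos'' u) = \<alpha> u" and \<alpha>: "\<forall>u\<in>C. \<alpha> u < q"
    and p: "\<forall>i\<le>q. s ''p'' i = p i \<and> p i < e\<^sub>0"
    and v: "v < n" "s ''v'' 0 = v" and best: "s ''best'' 0 = e\<^sub>0 + n"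
  shows "runs Best_Sink s (R * (R * 200))
    (\<lambda>s'. s' ''best'' 0 = Min ((\<lambda>i. p i + cut_cost \<alpha> v i) ` sinks \<alpha> v))"
proof -
  let ?val = "\<lambda>i. p i + cut_cost \<alpha> v i"
  let ?X = "\<lambda>j. ?val ` (sinks \<alpha> v \<inter> {..<j})"
  let ?g = "And_Exp (adj_exp (Var ''v'') (Var ''u'')) (And_Exp (Read ''cv'' (Var ''u''))
          (And_Exp (Not_Exp (Eq_Exp (part_exp (Var ''u'')) (Var ''i'')))
            (Or_Exp (Not_Exp (Read ''cv'' (Var ''v''))) (Less_Exp (Var ''u'') (Var ''v'')))))"
  let ?sum = "Sum_If ''u'' (Var ''in'') ?g (Const 1) ''s''"
  let ?upd = "Cond (And_Exp (Or_Exp (Not_Exp (Read ''cv'' (Var ''v''))) (Eq_Exp (part_exp (Var ''v'')) (Var ''i'')))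
        (Less_Exp (Var ''s'') (Var ''best''))) (Assign ''best'' (Var ''s'')) Skip"
  let ?body = "Seq (Assign ''s'' (Read ''p'' (Var ''i''))) (Seq ?sum ?upd)"
  have "runs Best_Sink s (R * (R * 200))
    (\<lambda>s'. s' ''best'' 0 = Min (insert (e\<^sub>0 + n) (?X (Suc q))))"
    unfolding Best_Sink_def
  proof (rule runs_For[where T = "5 + (R * 110 + 100)" and N = "Suc q" and
        P = "\<lambda>j s'. s' ''best'' 0 = Min (insert (e\<^sub>0 + n) (?X j))"], goal_cases)
    case (5 i s1)
    have ag1: "agree s1" using s 5(3) by (simp add: agree_def)
    have s1: "s1 ''a'' = s ''a''" "s1 ''p'' = s ''p''" "s1 ''v'' = s ''v''" using 5(3) by simp_all
    have i: "i \<le> q" using 5(1) by simp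
    show ?case
    proof (rule runs_Seq)
      show "runs (Assign ''s'' (Read ''p'' (Var ''i''))) s1 5 (\<lambda>s'. s' ''s'' 0 = p i)"
        using p i s1 5(2) by (intro runs_straight) auto
      fix s2 assume f2: "\<And>y. y \<notin> assigned (Assign ''s'' (Read ''p'' (Var ''i''))) \<Longrightarrow> s2 y = s1 y"
        and s2: "s2 ''s'' 0 = p i"
      have ag2: "agree s2" using ag1 f2 by (simp add: agree_def)
      have s2': "s2 ''a'' = s ''a''" "s2 ''v'' 0 = v" "s2 ''i'' 0 = i" "s2 ''best'' = s1 ''best''"
        using f2 s1 v 5(2) by simp_all
      show "runs (Seq ?sum ?upd) s2 (R * 110 + 100)
        (\<lambda>s'. s' ''best'' 0 = Min (insert (e\<^sub>0 + n) (?X (Suc i))))"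
      proof (rule runs_Seq)
        let ?G = "\<lambda>u. {v, u} \<in> E \<and> u \<in> C \<and> \<alpha> u \<noteq> i \<and> (v \<in> C \<longrightarrow> u < v)"
        show "runs ?sum s2 (R * 110) (\<lambda>s'. s' ''s'' 0 = s2 ''s'' 0 + (\<Sum>u<n. if ?G u then 1 else 0))"
        proof (rule runs_Sum_If, goal_cases)
          case (3 s3 u)
          have "agree s3" using ag2 3(3) by (simp add: agree_def)
          moreover have "s3 ''a'' = s ''a''" "s3 ''v'' 0 = v" "s3 ''i'' 0 = i" using 3(3) s2' by simp_all
          \<comment> \<open>Outside the cover the part read by the guard is arbitrary; the factor
            \<open>cv\<close> makes the guard fail there, hence the case distinction.\<close>
          ultimately show ?case using 3(1,2) a v(1)
            by (cases "u \<in> C"; cases "v \<in> C") (simp_all add: agree_simps cv adj)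
        next
          case (2 s3)
          then show ?case using ag2 by (simp add: agree_simps input)
        qed (auto simp: acost_defs)
        fix s3 assume f3: "\<And>y. y \<notin> assigned ?sum \<Longrightarrow> s3 y = s2 y"
          and s3: "s3 ''s'' 0 = s2 ''s'' 0 + (\<Sum>u<n. if ?G u then 1 else 0)"
        have ag3: "agree s3" using ag2 f3 by (simp add: agree_def)
        have s3': "s3 ''a'' = s ''a''" "s3 ''v'' 0 = v" "s3 ''i'' 0 = i" "s3 ''best'' = s1 ''best''"
          using f3 s2' by simp_all
        have "{u\<in>{..<n}. ?G u} = {u \<in> C. {v, u} \<in> E \<and> \<alpha> u \<noteq> i \<and> (v \<in> C \<longrightarrow> u < v)}"
          using C_sub by auto
        then have val: "s3 ''s'' 0 = ?val i"
          using s3 s2 by (simp add: sum_if_one cut_cost_def)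
        have i_sinks: "0 < aval (Or_Exp (Not_Exp (Read ''cv'' (Var ''v''))) (Eq_Exp (part_exp (Var ''v'')) (Var ''i''))) s3
            \<longleftrightarrow> i \<in> sinks \<alpha> v"
          using ag3 s3' a v(1) i by (cases "v \<in> C") (auto simp: agree_simps cv sinks_def)
        have X: "?X (Suc i) = (if i \<in> sinks \<alpha> v then insert (?val i) (?X i) else ?X i)"
          by (auto simp: less_Suc_eq)
        have Min: "Min (insert (e\<^sub>0 + n) (?X (Suc i))) =
          (if i \<in> sinks \<alpha> v then min (?val i) (s1 ''best'' 0) else s1 ''best'' 0)"
          unfolding X 5(4) by (simp add: insert_commute[of _ "?val i"])
        show "runs ?upd s3 100 (\<lambda>s'. s' ''best'' 0 = Min (insert (e\<^sub>0 + n) (?X (Suc i))))"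
          unfolding Min
        proof (intro runs_straight, goal_cases)
          case 3
          have "0 < aval (And_Exp (Or_Exp (Not_Exp (Read ''cv'' (Var ''v''))) (Eq_Exp (part_exp (Var ''v'')) (Var ''i'')))
              (Less_Exp (Var ''s'') (Var ''best''))) s3 \<longleftrightarrow> i \<in> sinks \<alpha> v \<and> ?val i < s1 ''best'' 0"
            using i_sinks val s3' by simp
          then show ?case using val s3' by (auto simp del: aval_And aval_Or)
        qed (simp_all add: acost_defs)
      qed
    qed
  next
    case 4
    then show ?case using best by simp
  qed (use s q_le_n in \<open>auto simp: agree_simps params\<close>)
  moreover have "Min (insert (e\<^sub>0 + n) (?X (Suc q))) = Min (?val ` sinks \<alpha> v)"
  proof -
    have sub: "sinks \<alpha> v \<subseteq> {..<Suc q}" and ne: "sinks \<alpha> v \<noteq> {}"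
      using \<alpha> by (auto simp: sinks_def less_Suc_eq_le less_imp_le)
    then have fin: "finite (sinks \<alpha> v)" using finite_subset by blast
    have X: "?X (Suc q) = ?val ` sinks \<alpha> v" using sub by (simp add: Int_absorb2)
    obtain i where i: "i \<in> sinks \<alpha> v" using ne by blast
    then have "p i < e\<^sub>0" using p sub by auto
    then have "?val i \<le> e\<^sub>0 + n" using cut_cost_le[of \<alpha> v i] by simp
    moreover have "Min (?val ` sinks \<alpha> v) \<le> ?val i" using i fin by simp
    ultimately show ?thesis unfolding X using fin ne by simp
  qed
  ultimately show ?thesis by simp
qed

lemma runs_Dual:
  assumes s: "agree s" and a: "\<forall>u\<in>C. s ''a'' (g ''pos'' u) = \<alpha> u" and \<alpha>: "\<forall>u\<in>C. \<alpha> u < q"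
    and p: "\<forall>i\<le>q. s ''p'' i = p i \<and> p i < e\<^sub>0"
  shows "runs Dual s (3 + R * (R * (R * 250))) (\<lambda>s'. s' ''lhs'' 0 = dual \<alpha> p)"
  unfolding Dual_def
proof (rule runs_Seq)
  let ?body = "Seq (Assign ''best'' (Add (Var ''e'') (Var ''in'')))
    (Seq Best_Sink (Assign ''lhs'' (Add (Var ''lhs'') (Var ''best''))))"
  show "runs (Assign ''lhs'' (Const 0)) s 3 (\<lambda>s'. s' ''lhs'' 0 = 0)"
    by (intro runs_straight) auto
  fix s1 assume f1: "\<And>y. y \<notin> assigned (Assign ''lhs'' (Const 0)) \<Longrightarrow> s1 y = s y" and s1: "s1 ''lhs'' 0 = 0"
  have ag1: "agree s1" using s f1 by (simp add: agree_def)
  have s1': "s1 ''a'' = s ''a''" "s1 ''p'' = s ''p''" using f1 by simp_all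
  show "runs (For ''v'' (Var ''in'') ?body) s1 (R * (R * (R * 250))) (\<lambda>s'. s' ''lhs'' 0 = dual \<alpha> p)"
    unfolding dual_def
  proof (rule runs_For[where T = "7 + (R * (R * 200) + 10)" and N = n and
        P = "\<lambda>v s'. s' ''lhs'' 0 = (\<Sum>v<v. Min ((\<lambda>i. p i + cut_cost \<alpha> v i) ` sinks \<alpha> v))"], goal_cases)
    case (5 v s2)
    have ag2: "agree s2" using ag1 5(3) by (simp add: agree_def)
    have s2': "s2 ''a'' = s ''a''" "s2 ''p'' = s ''p''" using 5(3) s1' by simp_all
    show ?case
    proof (rule runs_Seq)
      show "runs (Assign ''best'' (Add (Var ''e'') (Var ''in''))) s2 7 (\<lambda>s'. s' ''best'' 0 = e\<^sub>0 + n)"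
        using ag2 by (intro runs_straight) (auto simp: agree_simps input)
      fix s3 assume f3: "\<And>y. y \<notin> assigned (Assign ''best'' (Add (Var ''e'') (Var ''in''))) \<Longrightarrow> s3 y = s2 y"
        and s3: "s3 ''best'' 0 = e\<^sub>0 + n"
      have ag3: "agree s3" using ag2 f3 by (simp add: agree_def)
      have s3': "s3 ''a'' = s ''a''" "s3 ''p'' = s ''p''" "s3 ''v'' 0 = v" "s3 ''lhs'' = s2 ''lhs''"
        using f3 s2' 5(2) by simp_all
      show "runs (Seq Best_Sink (Assign ''lhs'' (Add (Var ''lhs'') (Var ''best'')))) s3 (R * (R * 200) + 10)
        (\<lambda>s'. s' ''lhs'' 0 = (\<Sum>v<Suc v. Min ((\<lambda>i. p i + cut_cost \<alpha> v i) ` sinks \<alpha> v)))"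
      proof (rule runs_Seq)
        show "runs Best_Sink s3 (R * (R * 200))
          (\<lambda>s'. s' ''best'' 0 = Min ((\<lambda>i. p i + cut_cost \<alpha> v i) ` sinks \<alpha> v))"
          by (rule runs_Best_Sink[OF ag3 _ \<alpha> _ 5(1)]) (use a p s3 s3' in simp_all)
        fix s4 assume f4: "\<And>y. y \<notin> assigned Best_Sink \<Longrightarrow> s4 y = s3 y"
          and s4: "s4 ''best'' 0 = Min ((\<lambda>i. p i + cut_cost \<alpha> v i) ` sinks \<alpha> v)"
        have "s4 ''lhs'' = s2 ''lhs''" using f4 s3' by simp
        then show "runs (Assign ''lhs'' (Add (Var ''lhs'') (Var ''best''))) s4 10
          (\<lambda>s'. s' ''lhs'' 0 = (\<Sum>v<Suc v. Min ((\<lambda>i. p i + cut_cost \<alpha> v i) ` sinks \<alpha> v)))"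
          using s4 5(4) by (intro runs_straight) auto
      qed
    qed
  next
    case 7
    have "7 + (R * (R * 200) + 10) + 2 + 10 \<le> R * (R * 250)"
      by (simp add: algebra_simps)
    then show ?case by simp
  qed (use ag1 s1 in \<open>auto simp: agree_simps input\<close>)
qed

text \<open>A common bound, up to constants, for one price test: evaluating the dual takes order
  \<open>R * R * R\<close>, decoding and pricing take order \<open>R * h\<^sub>0\<close>.\<close>

abbreviation "K \<equiv> R * R * R * h\<^sub>0"

lemma K_bounds: "R * h\<^sub>0 \<le> K" "R * (R * R) \<le> K" "R * R \<le> K" "1024 \<le> K"
proof -
  have RR: "1 \<le> R * R" "4 \<le> R * R * R" by (simp_all add: algebra_simps)
  have "1 * (R * h\<^sub>0) \<le> R * R * (R * h\<^sub>0)" using RR(1) by (rule mult_le_mono1)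
  then show "R * h\<^sub>0 \<le> K" by (simp only: ac_simps mult_1)
  have "R * R * R * 1 \<le> R * R * R * h\<^sub>0" using h_ge by (intro mult_le_mono2) simp
  then show RRR: "R * (R * R) \<le> K" by (simp only: ac_simps mult_1_right)
  have "1 * (R * R) \<le> R * (R * R)" by (rule mult_le_mono1) simp
  with RRR show "R * R \<le> K" by simp
  have "4 * 256 \<le> R * R * R * h\<^sub>0" using RR(2) h_ge by (rule mult_le_mono)
  then show "1024 \<le> K" by simp
qed

definition prices_ok :: "(nat \<Rightarrow> nat) \<Rightarrow> (nat \<Rightarrow> nat) \<Rightarrow> bool" where
  "prices_ok \<alpha> p \<longleftrightarrow> dual \<alpha> p \<le> k + (\<Sum>i\<le>q. sink_cap i * p i)"

text \<open>The flag is only ever cleared, so it survives exactly if all decoded prices pass. The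
  factor \<open>2 * h\<^sub>0\<close> bounds the \<open>h\<^sub>0 + 1\<close> of the loop
  rule.\<close>

lemma runs_Test_Prices:
  assumes s: "agree s" and a: "\<forall>u\<in>C. s ''a'' (g ''pos'' u) = \<alpha> u" and \<alpha>: "\<forall>u\<in>C. \<alpha> u < q"
  shows "runs Test_Prices s (2 * h\<^sub>0 * (K * 500))
    (\<lambda>s'. s' ''ok'' 0 = (if \<forall>M<h\<^sub>0. prices_ok \<alpha> (digit e\<^sub>0 M) then s ''ok'' 0 else 0))"
proof -
  let ?decode = "Decode ''p'' ''x2'' (Var ''e'') (Add (Var ''q'') (Const 1))"
  let ?upd = "Cond (Less_Exp (Var ''rhs'') (Var ''lhs'')) (Assign ''ok'' (Const 0)) Skip"
  let ?body = "Seq ?decode (Seq Price (Seq Dual ?upd))"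
  let ?T3 = "(3 + R * (R * (R * 250))) + 20"
  let ?T2 = "(4 + R * (h\<^sub>0 * 60)) + ?T3"
  let ?T = "(5 + R * (h\<^sub>0 * 100)) + ?T2"
  show ?thesis
    unfolding Test_Prices_def
  proof (rule runs_For[where T = ?T and N = h\<^sub>0 and
        P = "\<lambda>j s'. s' ''ok'' 0 = (if \<forall>M<j. prices_ok \<alpha> (digit e\<^sub>0 M) then s ''ok'' 0 else 0)"], goal_cases)
    case (5 M s1)
    have ag1: "agree s1" using s 5(3) by (simp add: agree_def)
    have s1: "s1 ''a'' = s ''a''" using 5(3) by simp
    define p where "p = digit e\<^sub>0 M"
    have p_less: "p i < e\<^sub>0" for i by (simp add: p_def digit_def e)
    show ?case
    proof (rule runs_Seq)
      show "runs ?decode s1 (5 + R * (h\<^sub>0 * 100)) (\<lambda>s'. \<forall>j<Suc q. s' ''p'' j = M div e\<^sub>0 ^ j mod e\<^sub>0)"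
      proof (rule runs_Decode[where N = M and h' = "h\<^sub>0 + 1"], goal_cases)
        case (2 s2)
        have "s2 ''e'' = s1 ''e''" using 2 by simp
        then show ?case using ag1 by (simp add: agree_simps)
      next
        case (3 s2)
        have "s2 ''q'' = s1 ''q''" using 3 by simp
        then show ?case using ag1 by (simp add: agree_simps params)
      qed (use ag1 5(1,2) q_le_n h_ge in \<open>auto simp: agree_simps e\<close>)
      fix s2 assume f2: "\<And>y. y \<notin> assigned ?decode \<Longrightarrow> s2 y = s1 y"
        and s2: "\<forall>j<Suc q. s2 ''p'' j = M div e\<^sub>0 ^ j mod e\<^sub>0"
      have ag2: "agree s2" using ag1 f2 by (simp add: agree_def)
      have s2': "s2 ''a'' = s ''a''" "s2 ''ok'' = s1 ''ok''" using f2 s1 by simp_all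
      have p2: "\<forall>i\<le>q. s2 ''p'' i = p i \<and> p i < e\<^sub>0"
        using s2 p_less by (simp add: p_def digit_def less_Suc_eq_le)
      show "runs (Seq Price (Seq Dual ?upd)) s2 ?T2
        (\<lambda>s'. s' ''ok'' 0 = (if \<forall>M'<Suc M. prices_ok \<alpha> (digit e\<^sub>0 M') then s ''ok'' 0 else 0))"
      proof (rule runs_Seq[OF runs_Price[OF ag2 p2]])
        fix s3 assume f3: "\<And>y. y \<notin> assigned Price \<Longrightarrow> s3 y = s2 y"
          and s3: "s3 ''rhs'' 0 = k + (\<Sum>i\<le>q. sink_cap i * p i)"
        have ag3: "agree s3" using ag2 f3 by (simp add: agree_def)
        have s3': "s3 ''a'' = s ''a''" "s3 ''p'' = s2 ''p''" "s3 ''ok'' = s1 ''ok''" using f3 s2' by simp_all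
        have a3: "\<forall>u\<in>C. s3 ''a'' (g ''pos'' u) = \<alpha> u" using a s3' by simp
        have p3: "\<forall>i\<le>q. s3 ''p'' i = p i \<and> p i < e\<^sub>0" using p2 s3' by simp
        show "runs (Seq Dual ?upd) s3 ?T3
          (\<lambda>s'. s' ''ok'' 0 = (if \<forall>M'<Suc M. prices_ok \<alpha> (digit e\<^sub>0 M') then s ''ok'' 0 else 0))"
        proof (rule runs_Seq[OF runs_Dual[OF ag3 a3 \<alpha> p3]])
          fix s4 assume f4: "\<And>y. y \<notin> assigned Dual \<Longrightarrow> s4 y = s3 y"
            and s4: "s4 ''lhs'' 0 = dual \<alpha> p"
          have s4': "s4 ''rhs'' 0 = k + (\<Sum>i\<le>q. sink_cap i * p i)" "s4 ''ok'' = s1 ''ok''"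
            using f4 s3 s3' by simp_all
          have "0 < aval (Less_Exp (Var ''rhs'') (Var ''lhs'')) s4 \<longleftrightarrow> \<not> prices_ok \<alpha> p"
            using s4 s4' by (simp add: prices_ok_def not_le)
          then show "runs ?upd s4 20
            (\<lambda>s'. s' ''ok'' 0 = (if \<forall>M'<Suc M. prices_ok \<alpha> (digit e\<^sub>0 M') then s ''ok'' 0 else 0))"
            using s4'(2) 5(4)
            by (intro runs_straight) (auto simp: less_Suc_eq p_def acost_defs simp del: aval_Less)
        qed
      qed
    qed
  next
    case 7
    have "?T + acost (Var ''h'') + 10 = R * h\<^sub>0 * 160 + R * (R * R) * 250 + 44"
      by (simp add: algebra_simps)
    also have "\<dots> \<le> K * 500" using K_bounds by linarith
    finally show ?case .
  qed (use s h_ge in \<open>auto simp: agree_simps\<close>)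
qed

definition guess :: "nat \<Rightarrow> nat \<Rightarrow> nat" where
  "guess N u = digit q N (g ''pos'' u)"

lemma q_pos: "u \<in> C \<Longrightarrow> 0 < q"
  using d card_gt_0_iff[of C] by (auto simp: q_def)

lemma guess_less: "u \<in> C \<Longrightarrow> guess N u < q"
  using q_pos by (simp add: guess_def digit_def)

definition accepts :: "nat \<Rightarrow> bool" where
  "accepts N \<longleftrightarrow> guess_ok (guess N) \<and> (\<forall>M<h\<^sub>0. prices_ok (guess N) (digit e\<^sub>0 M))"

text \<open>The output flag is only ever set, which realises the existential quantifier. Guesses,
  prices and the repeated subtractions hidden in \<open>K\<close> contribute one factor
  \<open>h\<^sub>0\<close> each.\<close>

lemma runs_Search:
  assumes s: "agree s" and out: "s ''out'' 0 = 0"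
  shows "runs Search s (2 * h\<^sub>0 * (K * h\<^sub>0 * 1500))
    (\<lambda>s'. s' ''out'' 0 = (if \<exists>N<h\<^sub>0. accepts N then 1 else 0))"
proof -
  let ?decode = "Decode ''a'' ''x1'' (Var ''q'') (Var ''m'')"
  let ?upd = "Cond (Var ''ok'') (Assign ''out'' (Const 1)) Skip"
  let ?T4 = "2 * h\<^sub>0 * (K * 500) + 20"
  let ?T3 = "R * (R * 100) + ?T4"
  let ?T2 = "3 + ?T3"
  let ?T = "(5 + R * (h\<^sub>0 * 100)) + ?T2"
  show ?thesis
    unfolding Search_def
  proof (rule runs_For[where T = ?T and N = h\<^sub>0 and
        P = "\<lambda>j s'. s' ''out'' 0 = (if \<exists>N<j. accepts N then 1 else 0)"], goal_cases)
    case (5 N s1)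
    have ag1: "agree s1" using s 5(3) by (simp add: agree_def)
    show ?case
    proof (rule runs_Seq)
      show "runs ?decode s1 (5 + R * (h\<^sub>0 * 100)) (\<lambda>s'. \<forall>j<card C. s' ''a'' j = N div q ^ j mod q)"
      proof (rule runs_Decode[where N = N and h' = "h\<^sub>0 + 1"], goal_cases)
        case (2 s2)
        have "s2 ''q'' = s1 ''q''" using 2 by simp
        then show ?case using ag1 by (simp add: agree_simps params)
      next
        case (3 s2)
        have "s2 ''m'' = s1 ''m''" using 3 by simp
        then show ?case using ag1 by (simp add: agree_simps params)
      next
        case 4
        then show ?case using d by (simp add: q_def)
      qed (use ag1 5(1,2) card_C_le h_ge in \<open>auto simp: agree_simps\<close>)
      fix s2 assume f2: "\<And>y. y \<notin> assigned ?decode \<Longrightarrow> s2 y = s1 y"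
        and s2: "\<forall>j<card C. s2 ''a'' j = N div q ^ j mod q"
      have ag2: "agree s2" using ag1 f2 by (simp add: agree_def)
      have s2': "s2 ''out'' = s1 ''out''" using f2 by simp
      have a2: "\<forall>u\<in>C. s2 ''a'' (g ''pos'' u) = guess N u"
        using s2 pos_less by (simp add: guess_def digit_def)
      show "runs (Seq (Assign ''ok'' (Const 1)) (Seq Check (Seq Test_Prices ?upd))) s2 ?T2
        (\<lambda>s'. s' ''out'' 0 = (if \<exists>N'<Suc N. accepts N' then 1 else 0))"
      proof (rule runs_Seq)
        show "runs (Assign ''ok'' (Const 1)) s2 3 (\<lambda>s'. s' ''ok'' 0 = 1)"
          by (intro runs_straight) auto
        fix s3 assume f3: "\<And>y. y \<notin> assigned (Assign ''ok'' (Const 1)) \<Longrightarrow> s3 y = s2 y"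
          and s3: "s3 ''ok'' 0 = 1"
        have ag3: "agree s3" using ag2 f3 by (simp add: agree_def)
        have s3': "s3 ''a'' = s2 ''a''" "s3 ''out'' = s1 ''out''" using f3 s2' by simp_all
        have a3: "\<forall>u\<in>C. s3 ''a'' (g ''pos'' u) = guess N u" using a2 s3' by simp
        show "runs (Seq Check (Seq Test_Prices ?upd)) s3 ?T3
          (\<lambda>s'. s' ''out'' 0 = (if \<exists>N'<Suc N. accepts N' then 1 else 0))"
        proof (rule runs_Seq[OF runs_Check[OF ag3 a3]])
          show "\<forall>u\<in>C. guess N u < q" using guess_less by simp
          fix s4 assume f4: "\<And>y. y \<notin> assigned Check \<Longrightarrow> s4 y = s3 y"
            and s4: "s4 ''ok'' 0 = (if guess_ok (guess N) then s3 ''ok'' 0 else 0)"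
          have ag4: "agree s4" using ag3 f4 by (simp add: agree_def)
          have s4': "s4 ''a'' = s3 ''a''" "s4 ''out'' = s1 ''out''" using f4 s3' by simp_all
          have a4: "\<forall>u\<in>C. s4 ''a'' (g ''pos'' u) = guess N u" using a3 s4' by simp
          show "runs (Seq Test_Prices ?upd) s4 ?T4
            (\<lambda>s'. s' ''out'' 0 = (if \<exists>N'<Suc N. accepts N' then 1 else 0))"
          proof (rule runs_Seq[OF runs_Test_Prices[OF ag4 a4]])
            show "\<forall>u\<in>C. guess N u < q" using guess_less by simp
            fix s5 assume f5: "\<And>y. y \<notin> assigned Test_Prices \<Longrightarrow> s5 y = s4 y"
              and s5: "s5 ''ok'' 0 =
                (if \<forall>M<h\<^sub>0. prices_ok (guess N) (digit e\<^sub>0 M) then s4 ''ok'' 0 else 0)"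
            have "s5 ''out'' = s1 ''out''" using f5 s4' by simp
            moreover have "s5 ''ok'' 0 = (if accepts N then 1 else 0)"
              using s5 s4 s3 by (simp add: accepts_def)
            ultimately show "runs ?upd s5 20
              (\<lambda>s'. s' ''out'' 0 = (if \<exists>N'<Suc N. accepts N' then 1 else 0))"
              using 5(4) by (intro runs_straight) (auto simp: less_Suc_eq)
          qed
        qed
      qed
    qed
  next
    case 7
    have "?T + acost (Var ''h'') + 10 = R * h\<^sub>0 * 100 + R * R * 100 + K * h\<^sub>0 * 1000 + 40"
      by (simp add: algebra_simps)
    also have "\<dots> \<le> K * 300 + K * h\<^sub>0 * 1000" using K_bounds by linarith
    also have "\<dots> \<le> K * h\<^sub>0 * 300 + K * h\<^sub>0 * 1000"
      using h_ge by (intro add_mono mult_le_mono1) simp_all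
    also have "\<dots> \<le> K * h\<^sub>0 * 1500" by simp
    finally show ?case .
  qed (use s out h_ge in \<open>auto simp: agree_simps\<close>)
qed

text \<open>This is where \<open>e\<close> and \<open>h\<close> come from. With m cover vertices,
  \<open>e\<close> is a power of two that is at least (m + 3)(m + 1), so the
  \<open>e ^ Suc q\<close> price vectors number at most \<open>2 ^ ((m + 3) * (m + 1))\<close>,
  which is at most \<open>2 ^ e = h\<close>. Powers of two are used because the machine obtains them
  by doubling.\<close>

lemma price_base_large: "q * card C < e\<^sub>0" and guess_space: "q ^ card C \<le> h\<^sub>0"
  and price_space: "e\<^sub>0 ^ Suc q \<le> h\<^sub>0"
proof -
  let ?m = "card C"
  have e': "(?m + 3) * Suc ?m \<le> e\<^sub>0"
  proof -
    \<comment> \<open>The summand 5 strengthens the claim for the induction; it makes the case 0 an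
      equality.\<close>
    have "(m + 3) * Suc m + 5 \<le> 2 ^ (m + 3)" for m :: nat
    proof (induction m)
      case (Suc m)
      have "2 ^ (Suc m + 3) = 2 * (2::nat) ^ (m + 3)" by (simp only: add_Suc power_Suc)
      then show ?case using Suc by (simp add: algebra_simps)
    qed simp
    from this[of ?m] show ?thesis by (simp add: e)
  qed
  have "q * ?m \<le> ?m * ?m" using q_le_card by simp
  also have "\<dots> < (?m + 3) * Suc ?m" by (simp add: algebra_simps)
  finally show "q * card C < e\<^sub>0" using e' by simp
  have "e\<^sub>0 ^ Suc q = 2 ^ ((?m + 3) * Suc q)" by (simp only: e power_mult)
  also have "\<dots> \<le> 2 ^ e\<^sub>0"
  proof (rule power_increasing)
    have "(?m + 3) * Suc q \<le> (?m + 3) * Suc ?m" using q_le_card by (intro mult_le_mono2) simp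
    then show "(?m + 3) * Suc q \<le> e\<^sub>0" using e' by (rule order_trans)
  qed simp
  finally show "e\<^sub>0 ^ Suc q \<le> h\<^sub>0" by (simp add: h)
  have "q < e\<^sub>0"
  proof -
    have "q \<le> ?m" by (rule q_le_card)
    also have "\<dots> < (?m + 3) * Suc ?m" by simp
    finally show ?thesis using e' by simp
  qed
  then have "q ^ ?m \<le> e\<^sub>0 ^ ?m" by (intro power_mono) simp_all
  also have "\<dots> = 2 ^ ((?m + 3) * ?m)" by (simp only: e power_mult)
  also have "\<dots> \<le> 2 ^ e\<^sub>0"
  proof (rule power_increasing)
    show "(?m + 3) * ?m \<le> e\<^sub>0" using e' by simp
  qed simp
  finally show "q ^ card C \<le> h\<^sub>0" by (simp add: h)
qed

text \<open>A decoded number fixes the parts of cover vertices only, while the guess supplied by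
  duality is a function on all numbers; the two have to be interchangeable.\<close>

lemma dual_cong_guess: "(\<And>u. u \<in> C \<Longrightarrow> \<alpha> u = \<beta> u) \<Longrightarrow> dual \<alpha> p = dual \<beta> p"
proof -
  assume eq: "\<And>u. u \<in> C \<Longrightarrow> \<alpha> u = \<beta> u"
  have "cut_cost \<alpha> v i = cut_cost \<beta> v i" for v i
    unfolding cut_cost_def using eq by (intro arg_cong[where f = card]) auto
  moreover have "sinks \<alpha> v = sinks \<beta> v" for v
    using eq by (simp add: sinks_def)
  ultimately show ?thesis by (simp add: dual_def)
qed

lemma guess_ok_cong: "(\<And>u. u \<in> C \<Longrightarrow> \<alpha> u = \<beta> u) \<Longrightarrow> guess_ok \<alpha> \<longleftrightarrow> guess_ok \<beta>"
proof -
  assume eq: "\<And>u. u \<in> C \<Longrightarrow> \<alpha> u = \<beta> u"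
  then have "{u\<in>C. \<alpha> u = i} = {u\<in>C. \<beta> u = i}" for i by auto
  with eq show ?thesis by (simp add: guess_ok_def)
qed

text \<open>Prices matter at admissible sinks only, and \<open>guess_ok\<close> ensures that these
  lie in \<open>{..q}\<close>.\<close>

lemma dual_cong_prices:
  assumes ok: "guess_ok \<alpha>" and eq: "\<And>i. i \<le> q \<Longrightarrow> p i = p' i"
  shows "dual \<alpha> p = dual \<alpha> p'"
proof -
  have "sinks \<alpha> v \<subseteq> {..q}" if "v < n" for v
    using transport.AS[OF transport[OF ok]] that by auto
  then have "(\<lambda>i. p i + cut_cost \<alpha> v i) ` sinks \<alpha> v = (\<lambda>i. p' i + cut_cost \<alpha> v i) ` sinks \<alpha> v"
    if "v < n" for v
    using that eq by (intro image_cong) auto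
  then show ?thesis by (simp add: dual_def)
qed

text \<open>Soundness uses that all price vectors below \<open>e\<close> occur among the decoded
  ones, completeness that the desired guess occurs. Extra numbers are harmless, as their digits are
  again legal prices and parts.\<close>

lemma ex_accepts_iff: "(\<exists>N<h\<^sub>0. accepts N) \<longleftrightarrow> has_balanced_partition {..<n} E k d"
  unfolding balanced_iff_dual[OF price_base_large]
proof
  assume "\<exists>N<h\<^sub>0. accepts N"
  then obtain N where N: "guess_ok (guess N)" "\<forall>M<h\<^sub>0. prices_ok (guess N) (digit e\<^sub>0 M)"
    by (auto simp: accepts_def)
  show "\<exists>\<alpha>. guess_ok \<alpha> \<and> (\<forall>p. (\<forall>i\<le>q. p i < e\<^sub>0) \<longrightarrow> dual \<alpha> p \<le> k + (\<Sum>i\<le>q. sink_cap i * p i))"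
  proof (intro exI[of _ "guess N"] conjI allI impI)
    fix p :: "nat \<Rightarrow> nat" assume "\<forall>i\<le>q. p i < e\<^sub>0"
    then obtain M where M: "M < e\<^sub>0 ^ Suc q" "\<forall>i<Suc q. M div e\<^sub>0 ^ i mod e\<^sub>0 = p i"
      using ex_digits[of "Suc q" p e\<^sub>0] by (auto simp: less_Suc_eq_le)
    have eq: "digit e\<^sub>0 M i = p i" if "i \<le> q" for i
      using M(2) that by (simp add: digit_def)
    have "prices_ok (guess N) (digit e\<^sub>0 M)" using N(2) M(1) price_space by simp
    moreover have "dual (guess N) (digit e\<^sub>0 M) = dual (guess N) p"
      using N(1) eq by (rule dual_cong_prices)
    ultimately show "dual (guess N) p \<le> k + (\<Sum>i\<le>q. sink_cap i * p i)"
      using eq by (simp add: prices_ok_def)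
  qed (rule N(1))
next
  assume "\<exists>\<alpha>. guess_ok \<alpha> \<and> (\<forall>p. (\<forall>i\<le>q. p i < e\<^sub>0) \<longrightarrow> dual \<alpha> p \<le> k + (\<Sum>i\<le>q. sink_cap i * p i))"
  then obtain \<alpha> where \<alpha>: "guess_ok \<alpha>"
    "\<And>p. \<forall>i\<le>q. p i < e\<^sub>0 \<Longrightarrow> dual \<alpha> p \<le> k + (\<Sum>i\<le>q. sink_cap i * p i)" by blast
  \<comment> \<open>The guess is read along the numbering \<open>pos\<close>; the default 0 is a
    legal digit, since \<open>q\<close> is positive as soon as there is a position.\<close>
  define a where "a j = (if j \<in> g ''pos'' ` C then \<alpha> (inv_into C (g ''pos'') j) else 0)" for j
  have "\<forall>j<card C. a j < q"
  proof (intro allI impI)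
    fix j assume "j < card C"
    then have "C \<noteq> {}" by auto
    then have "0 < q" using q_pos by blast
    then show "a j < q" using \<alpha>(1) by (auto simp: a_def guess_ok_def inv_into_into)
  qed
  then obtain N where N: "N < q ^ card C" "\<forall>j<card C. N div q ^ j mod q = a j"
    using ex_digits by blast
  have eq: "guess N u = \<alpha> u" if "u \<in> C" for u
    using N(2) pos_less[OF that] pos_inj that by (simp add: guess_def digit_def a_def)
  have "guess_ok (guess N)" using \<alpha>(1) guess_ok_cong[OF eq] by simp
  moreover have "prices_ok (guess N) (digit e\<^sub>0 M)" for M
  proof -
    have "digit e\<^sub>0 M i < e\<^sub>0" for i by (simp add: digit_def e)
    moreover have "dual (guess N) (digit e\<^sub>0 M) = dual \<alpha> (digit e\<^sub>0 M)"
      using eq by (rule dual_cong_guess)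
    ultimately show ?thesis using \<alpha>(2)[of "digit e\<^sub>0 M"] by (simp only: prices_ok_def simp_thms)
  qed
  ultimately show "\<exists>N<h\<^sub>0. accepts N"
    using N(1) guess_space by (intro exI[of _ N]) (auto simp: accepts_def)
qed

end

section \<open>Preparing the search\<close>

text \<open>Row offsets of the adjacency matrix, accumulated by addition. They start at 3 because
  \<open>n\<close>, \<open>k\<close> and \<open>d\<close> occupy the first cells.\<close>

definition Rows :: com where
  "Rows = Seq (Write ''row'' (Const 0) (Const 3))
     (For ''v'' (Var ''in'')
       (Write ''row'' (Add (Var ''v'') (Const 1)) (Add (Read ''row'' (Var ''v'')) (Var ''in''))))"

definition Add_To_Cover :: "aexp \<Rightarrow> com" where
  "Add_To_Cover v = Seq (Write ''cv'' v (Const 1))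
     (Seq (Write ''pos'' v (Var ''m'')) (Assign ''m'' (Add (Var ''m'') (Const 1))))"

definition Cover :: com where
  "Cover = For ''v'' (Var ''in'') (For ''u'' (Var ''in'')
     (Cond (And_Exp (adj_exp (Var ''v'') (Var ''u''))
         (And_Exp (Not_Exp (Read ''cv'' (Var ''v''))) (Not_Exp (Read ''cv'' (Var ''u'')))))
       (Seq (Add_To_Cover (Var ''v'')) (Add_To_Cover (Var ''u''))) Skip))"

text \<open>Counts how often \<open>d\<close> can be subtracted while something is left. Truncation
  takes care of the last, incomplete portion, so the quotient is rounded up.\<close>

definition Part_Bound :: com where
  "Part_Bound = Seq (Seq (Assign ''r'' (Var ''in'')) (Assign ''cap'' (Const 0)))
     (For ''t'' (Var ''in'')
       (Cond (Var ''r'')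
         (Seq (Assign ''cap'' (Add (Var ''cap'') (Const 1)))
           (Assign ''r'' (Sub (Var ''r'') (Read ''in'' (Const 2))))) Skip))"

text \<open>The double subtraction is the minimum of \<open>m\<close> and \<open>d\<close>. In the
  product for the pooled sink the loop runs over \<open>cap\<close>, which is at most
  \<open>n\<close>, and not over the possibly huge \<open>d - q\<close>.\<close>

definition Sink_Caps :: com where
  "Sink_Caps = Seq (Assign ''q'' (Sub (Var ''m'') (Sub (Var ''m'') (Read ''in'' (Const 2)))))
     (Seq (For ''i'' (Var ''q'') (Write ''cp'' (Var ''i'') (Var ''cap'')))
     (Seq (Assign ''c'' (Const 0))
     (Seq (Sum_If ''t'' (Var ''cap'') (Const 1) (Sub (Read ''in'' (Const 2)) (Var ''q'')) ''c'')
     (Write ''cp'' (Var ''q'') (Var ''c'')))))"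

definition Balanced :: com where
  "Balanced = Seq Rows (Seq Cover (Seq Part_Bound (Seq Sink_Caps
     (Seq (Pow2 ''e'' (Add (Var ''m'') (Const 3))) (Seq (Pow2 ''h'' (Var ''e'')) Search)))))"

lemma assigned_Rows [simp]: "assigned Rows = {''v'', ''row''}"
  by (auto simp: Rows_def)

lemma assigned_Cover [simp]: "assigned Cover = {''v'', ''u'', ''cv'', ''pos'', ''m''}"
  by (auto simp: Cover_def Add_To_Cover_def)

lemma assigned_Part_Bound [simp]: "assigned Part_Bound = {''r'', ''cap'', ''t''}"
  by (auto simp: Part_Bound_def)

lemma assigned_Sink_Caps [simp]: "assigned Sink_Caps = {''q'', ''i'', ''cp'', ''c'', ''t''}"
  by (auto simp: Sink_Caps_def)

section \<open>Correctness and running time of the preparation\<close>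

lemma runs_Rows:
  assumes "s ''in'' 0 = n"
  shows "runs Rows s (3 + (n + 4) * 30) (\<lambda>s'. \<forall>i\<le>n. s' ''row'' i = 3 + i * n)"
  unfolding Rows_def
proof (rule runs_Seq)
  let ?body = "Write ''row'' (Add (Var ''v'') (Const 1)) (Add (Read ''row'' (Var ''v'')) (Var ''in''))"
  show "runs (Write ''row'' (Const 0) (Const 3)) s 3 (\<lambda>s'. s' ''row'' 0 = 3)"
    by (intro runs_straight) auto
  fix s1 assume f1: "\<And>y. y \<notin> assigned (Write ''row'' (Const 0) (Const 3)) \<Longrightarrow> s1 y = s y"
    and s1: "s1 ''row'' 0 = 3"
  have n: "s1 ''in'' 0 = n" using f1 assms by simp
  show "runs (For ''v'' (Var ''in'') ?body) s1 ((n + 4) * 30) (\<lambda>s'. \<forall>i\<le>n. s' ''row'' i = 3 + i * n)"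
  proof (rule runs_For[where T = 12 and N = n and P = "\<lambda>j s'. \<forall>i\<le>j. s' ''row'' i = 3 + i * n"], goal_cases)
    case (5 j s2)
    have "s2 ''in'' 0 = n" using 5(3) n by simp
    then show ?case using 5(2,4) by (intro runs_straight) (auto simp: le_Suc_eq)
  qed (use n s1 in auto)
qed

text \<open>
  Adding both ends of uncovered edges yields at most twice the minimum, since every vertex cover
  \<open>K\<close> contains one of the two ends. The pair \<open>(v, u)\<close> is the scanning position.
\<close>

definition greedy_cover :: "nat \<Rightarrow> nat set set \<Rightarrow> state \<Rightarrow> nat \<Rightarrow> nat \<Rightarrow> nat set \<Rightarrow> bool" where
  "greedy_cover n E s v u C \<longleftrightarrow> C \<subseteq> {..<n} \<and> (\<forall>w. s ''cv'' w = of_bool (w \<in> C)) \<and>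
     s ''m'' 0 = card C \<and> inj_on (s ''pos'') C \<and> (\<forall>w\<in>C. s ''pos'' w < card C) \<and>
     (\<forall>K. vertex_cover {..<n} E K \<longrightarrow> card C \<le> 2 * card (C \<inter> K)) \<and>
     (\<forall>v' u'. {v', u'} \<in> E \<and> (v' < v \<or> v' = v \<and> u' < u) \<longrightarrow> v' \<in> C \<or> u' \<in> C)"

text \<open>The two new positions continue the numbering. Whichever end lies in \<open>K\<close> is
  new in \<open>C \<inter> K\<close>, so this intersection gains at least one vertex while
  \<open>C\<close> gains two.\<close>

lemma greedy_cover_insert:
  assumes C: "greedy_cover n E s v u C" and uv: "{v, u} \<in> E" "v < n" "u < n" "v \<noteq> u" "v \<notin> C" "u \<notin> C"
    and s': "s' ''cv'' = (s ''cv'')(v := 1, u := 1)" "s' ''pos'' = (s ''pos'')(v := card C, u := Suc (card C))"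
      "s' ''m'' 0 = Suc (Suc (card C))"
  shows "greedy_cover n E s' v (Suc u) (insert v (insert u C))"
proof -
  let ?C = "insert v (insert u C)"
  have fin: "finite C" using C finite_subset by (auto simp: greedy_cover_def)
  have card: "card ?C = Suc (Suc (card C))" using fin uv by simp
  have pos: "w \<in> C \<Longrightarrow> s ''pos'' w < card C" for w using C by (simp add: greedy_cover_def)
  have pos': "s' ''pos'' w = s ''pos'' w" if "w \<in> C" for w
    using that uv by (auto simp: s'(2))
  have pos_v: "s' ''pos'' v = card C" and pos_u: "s' ''pos'' u = Suc (card C)"
    using uv by (simp_all add: s'(2))
  have "inj_on (s' ''pos'') C"
    using C inj_on_cong[of C "s' ''pos''" "s ''pos''"] pos' by (simp add: greedy_cover_def)
  moreover have below: "s' ''pos'' w < card C" if "w \<in> C" for w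
    using pos[OF that] pos'[OF that] by simp
  then have "card C \<notin> s' ''pos'' ` C" "Suc (card C) \<notin> s' ''pos'' ` C"
    by force+
  ultimately have "inj_on (s' ''pos'') ?C"
    using uv by (simp add: inj_on_insert pos_v pos_u insert_Diff_if)
  moreover have "\<forall>w\<in>?C. s' ''pos'' w < card ?C"
    using below by (simp add: card pos_v pos_u less_Suc_eq)
  moreover have "card ?C \<le> 2 * card (?C \<inter> K)" if K: "vertex_cover {..<n} E K" for K
  proof -
    have "card C \<le> 2 * card (C \<inter> K)" using C K by (simp add: greedy_cover_def)
    moreover have "\<forall>e\<in>E. e \<inter> K \<noteq> {}" using K by (simp add: vertex_cover_def)
    then have "{v, u} \<inter> K \<noteq> {}" using uv(1) by (rule bspec)
    then obtain w where w: "w \<in> {v, u}" "w \<in> K" by blast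
    have "card (insert w (C \<inter> K)) \<le> card (?C \<inter> K)"
      using w fin by (intro card_mono) auto
    moreover have "w \<notin> C" using w uv by auto
    ultimately show ?thesis unfolding card using fin by simp
  qed
  ultimately show ?thesis
    using C uv card s' unfolding greedy_cover_def by (auto simp: less_Suc_eq)
qed

lemma greedy_cover_step:
  assumes "greedy_cover n E s v u C" "{v, u} \<in> E \<Longrightarrow> v \<in> C \<or> u \<in> C"
  shows "greedy_cover n E s v (Suc u) C"
  using assms by (auto simp: greedy_cover_def less_Suc_eq)

lemma greedy_cover_next_row:
  assumes "greedy_cover n E s v n C" "simple_graph {..<n} E"
  shows "greedy_cover n E s (Suc v) 0 C"
proof -
  have "u' < n" if "{v', u'} \<in> E" for v' u'
    using assms(2) that by (auto simp: simple_graph_def)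
  then have "{v', u'} \<in> E \<and> (v' < Suc v \<or> v' = Suc v \<and> u' < 0) \<longleftrightarrow>
      {v', u'} \<in> E \<and> (v' < v \<or> v' = v \<and> u' < n)" for v' u'
    by (auto simp: less_Suc_eq)
  then show ?thesis using assms(1) unfolding greedy_cover_def by simp
qed

lemma greedy_cover_cong:
  "s' ''cv'' = s ''cv'' \<Longrightarrow> s' ''pos'' = s ''pos'' \<Longrightarrow> s' ''m'' = s ''m'' \<Longrightarrow>
    greedy_cover n E s' v u C = greedy_cover n E s v u C"
  by (simp add: greedy_cover_def)

text \<open>The cover is a logical variable under an existential quantifier in both invariants. The
  guard consults \<open>cv\<close> afresh at every position, so insertions made earlier in the same
  row count.\<close>

lemma runs_Cover:
  assumes graph: "simple_graph {..<n} E" and n: "s ''in'' 0 = n"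
    and adj: "\<And>u v. u < n \<Longrightarrow> v < n \<Longrightarrow> s ''in'' (s ''row'' v + u) = of_bool ({v, u} \<in> E)"
    and empty: "\<And>w. s ''cv'' w = 0" "s ''m'' 0 = 0"
  shows "runs Cover s ((n + 4) * ((n + 4) * 120)) (\<lambda>s'. \<exists>C. greedy_cover n E s' n 0 C)"
proof -
  let ?guard = "And_Exp (adj_exp (Var ''v'') (Var ''u''))
         (And_Exp (Not_Exp (Read ''cv'' (Var ''v''))) (Not_Exp (Read ''cv'' (Var ''u''))))"
  let ?body = "Cond ?guard (Seq (Add_To_Cover (Var ''v'')) (Add_To_Cover (Var ''u''))) Skip"
  have loopless: "v \<noteq> u" if "{v, u} \<in> E" for v u
    using graph that by (fastforce simp: simple_graph_def)
  show ?thesis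
    unfolding Cover_def
  proof (rule runs_For[where T = "(n + 4) * 100" and N = n and
        P = "\<lambda>v s'. \<exists>C. greedy_cover n E s' v 0 C"], goal_cases)
    case (1 j s' w)
    then show ?case by (simp add: greedy_cover_cong[of "s'(''v'' := w)" s'])
  next
    case 4
    show ?case using empty by (intro exI[of _ "{}"]) (simp add: greedy_cover_def)
  next
    case (5 v s1)
    have s1: "s1 ''in'' = s ''in''" "s1 ''row'' = s ''row''" using 5(3) by (simp_all add: Add_To_Cover_def)
    have "runs (For ''u'' (Var ''in'') ?body) s1 ((n + 4) * 100) (\<lambda>s'. \<exists>C. greedy_cover n E s' v n C)"
    proof (rule runs_For[where T = "80" and N = n and P = "\<lambda>u s'. \<exists>C. greedy_cover n E s' v u C"], goal_cases)
      case (1 j s' w)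
      then show ?case by (simp add: greedy_cover_cong[of "s'(''u'' := w)" s'])
    next
      case (3 s')
      have "s' ''in'' = s1 ''in''" using 3 by (simp add: Add_To_Cover_def)
      then show ?case using s1 n by simp
    next
      case (5 u s2)
      have s2: "s2 ''in'' = s ''in''" "s2 ''row'' = s ''row''" "s2 ''v'' 0 = v"
        using 5(3) s1 \<open>s1 ''v'' 0 = v\<close> by (simp_all add: Add_To_Cover_def)
      obtain C where C: "greedy_cover n E s2 v u C" using 5(4) by blast
      then have cv: "\<And>w. s2 ''cv'' w = of_bool (w \<in> C)" and m: "s2 ''m'' 0 = card C"
        by (simp_all add: greedy_cover_def)
      have guard: "0 < aval ?guard s2 \<longleftrightarrow> {v, u} \<in> E \<and> v \<notin> C \<and> u \<notin> C"
        using s2 cv \<open>v < n\<close> 5(1,2) by (simp add: adj)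
      show ?case
      proof (rule runs_straight)
        let ?s = "effect (Seq (Add_To_Cover (Var ''v'')) (Add_To_Cover (Var ''u''))) s2"
        show "\<exists>C. greedy_cover n E (effect ?body s2) v (Suc u) C"
        proof (cases "{v, u} \<in> E \<and> v \<notin> C \<and> u \<notin> C")
          case True
          have "greedy_cover n E ?s v (Suc u) (insert v (insert u C))"
            using True 5(1,2) \<open>v < n\<close> loopless s2 m
            by (intro greedy_cover_insert[OF C]) (auto simp: Add_To_Cover_def fun_eq_iff)
          moreover have "effect ?body s2 = ?s" using True guard by simp
          ultimately show ?thesis by metis
        next
          case False
          then have "\<not> 0 < aval ?guard s2" using guard by blast
          then have "effect ?body s2 = s2" by (simp del: aval_And)
          moreover have "greedy_cover n E s2 v (Suc u) C"
            using C False by (intro greedy_cover_step) auto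
          ultimately show ?thesis by metis
        qed
      qed (simp_all add: Add_To_Cover_def acost_defs)
    qed (use 5(4) in \<open>simp_all add: Add_To_Cover_def\<close>)
    then show ?case
      by (rule runs_conseq) (use greedy_cover_next_row[OF _ graph] in blast)+
  qed (use n in \<open>auto simp: Add_To_Cover_def\<close>)
qed

lemma runs_Part_Bound:
  assumes n: "s ''in'' 0 = n" "s ''in'' 2 = d" and d: "d > 0"
  shows "runs Part_Bound s (7 + (n + 4) * 40) (\<lambda>s'. s' ''cap'' 0 = part_bound n d)"
  unfolding Part_Bound_def
proof (rule runs_Seq)
  let ?init = "Seq (Assign ''r'' (Var ''in'')) (Assign ''cap'' (Const 0))"
  let ?body = "Cond (Var ''r'')
         (Seq (Assign ''cap'' (Add (Var ''cap'') (Const 1)))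
           (Assign ''r'' (Sub (Var ''r'') (Read ''in'' (Const 2))))) Skip"
  show "runs ?init s 7 (\<lambda>s'. s' ''r'' 0 = n \<and> s' ''cap'' 0 = 0)"
    using n by (intro runs_straight) auto
  fix s1 assume f1: "\<And>y. y \<notin> assigned ?init \<Longrightarrow> s1 y = s y" and s1: "s1 ''r'' 0 = n \<and> s1 ''cap'' 0 = 0"
  have in1: "s1 ''in'' = s ''in''" using f1 by simp
  have pb: "part_bound n d \<le> n" using d by (rule part_bound_le)
  have "runs (For ''t'' (Var ''in'') ?body) s1 ((n + 4) * 40)
    (\<lambda>s'. s' ''r'' 0 = n - n * d \<and> s' ''cap'' 0 = min n (part_bound n d))"
  proof (rule runs_For[where T = 25 and N = n and
        P = "\<lambda>j s'. s' ''r'' 0 = n - j * d \<and> s' ''cap'' 0 = min j (part_bound n d)"], goal_cases)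
    case (5 j s2)
    have "s2 ''in'' 2 = d" using 5(3) in1 n by simp
    \<comment> \<open>The remainder is positive exactly as long as the count has not reached the
      ceiling, so both parts of the invariant advance or stop together.\<close>
    moreover have "0 < n - j * d \<longleftrightarrow> j < part_bound n d"
      using less_part_bound_iff[OF d, of j n] by simp
    ultimately show ?case
      using 5(4) by (intro runs_straight) auto
  qed (use n in1 s1 in auto)
  then show "runs (For ''t'' (Var ''in'') ?body) s1 ((n + 4) * 40) (\<lambda>s'. s' ''cap'' 0 = part_bound n d)"
    by (rule runs_conseq) (use pb in auto)
qed

lemma runs_Sink_Caps:
  assumes s: "s ''in'' 2 = d" "s ''m'' 0 = m" "s ''cap'' 0 = b" and mn: "m \<le> n" and bn: "b \<le> n"
  shows "runs Sink_Caps s ((n + 4) * 70)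
    (\<lambda>s'. s' ''q'' 0 = min m d \<and> (\<forall>i\<le>min m d. s' ''cp'' i = (if i < min m d then b else (d - min m d) * b)))"
proof (rule runs_conseq)
  let ?q = "min m d"
  let ?sum = "Sum_If ''t'' (Var ''cap'') (Const 1) (Sub (Read ''in'' (Const 2)) (Var ''q'')) ''c''"
  let ?post = "\<lambda>s'. s' ''q'' 0 = ?q \<and> (\<forall>i\<le>?q. s' ''cp'' i = (if i < ?q then b else (d - ?q) * b))"
  show "runs Sink_Caps s (11 + ((n + 4) * 20 + (3 + ((n + 4) * 30 + 10)))) ?post"
    unfolding Sink_Caps_def
  proof (rule runs_Seq)
    show "runs (Assign ''q'' (Sub (Var ''m'') (Sub (Var ''m'') (Read ''in'' (Const 2))))) s 11 (\<lambda>s'. s' ''q'' 0 = ?q)"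
      using s by (intro runs_straight) auto
    fix s1 assume f1: "\<And>y. y \<notin> assigned (Assign ''q'' (Sub (Var ''m'') (Sub (Var ''m'') (Read ''in'' (Const 2))))) \<Longrightarrow> s1 y = s y"
      and s1: "s1 ''q'' 0 = ?q"
    have s1': "s1 ''in'' = s ''in''" "s1 ''cap'' = s ''cap''" using f1 by simp_all
    show "runs (Seq (For ''i'' (Var ''q'') (Write ''cp'' (Var ''i'') (Var ''cap'')))
        (Seq (Assign ''c'' (Const 0)) (Seq ?sum (Write ''cp'' (Var ''q'') (Var ''c''))))) s1
        ((n + 4) * 20 + (3 + ((n + 4) * 30 + 10))) ?post"
    proof (rule runs_Seq)
      show "runs (For ''i'' (Var ''q'') (Write ''cp'' (Var ''i'') (Var ''cap''))) s1 ((n + 4) * 20)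
        (\<lambda>s'. \<forall>i<?q. s' ''cp'' i = b)"
      proof (rule runs_For[where T = 5 and N = ?q and P = "\<lambda>j s'. \<forall>i<j. s' ''cp'' i = b"], goal_cases)
        case (5 j s2)
        have "s2 ''cap'' 0 = b" using 5(3) s1' s by simp
        then show ?case using 5(2,4) by (intro runs_straight) (auto simp: less_Suc_eq)
      qed (use s1 mn in auto)
      fix s2 assume f2: "\<And>y. y \<notin> assigned (For ''i'' (Var ''q'') (Write ''cp'' (Var ''i'') (Var ''cap''))) \<Longrightarrow> s2 y = s1 y"
        and s2: "\<forall>i<?q. s2 ''cp'' i = b"
      have s2': "s2 ''in'' = s ''in''" "s2 ''cap'' = s ''cap''" "s2 ''q'' 0 = ?q" using f2 s1' s1 by simp_all
      show "runs (Seq (Assign ''c'' (Const 0)) (Seq ?sum (Write ''cp'' (Var ''q'') (Var ''c'')))) s2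
        (3 + ((n + 4) * 30 + 10)) ?post"
      proof (rule runs_Seq)
        show "runs (Assign ''c'' (Const 0)) s2 3 (\<lambda>s'. s' ''c'' 0 = 0)"
          by (intro runs_straight) auto
        fix s3 assume f3: "\<And>y. y \<notin> assigned (Assign ''c'' (Const 0)) \<Longrightarrow> s3 y = s2 y" and s3: "s3 ''c'' 0 = 0"
        have s3': "s3 ''in'' = s ''in''" "s3 ''cap'' = s ''cap''" "s3 ''q'' 0 = ?q" "s3 ''cp'' = s2 ''cp''"
          using f3 s2' by simp_all
        show "runs (Seq ?sum (Write ''cp'' (Var ''q'') (Var ''c''))) s3 ((n + 4) * 30 + 10) ?post"
        proof (rule runs_Seq)
          show "runs ?sum s3 ((n + 4) * 30)
            (\<lambda>s'. s' ''c'' 0 = s3 ''c'' 0 + (\<Sum>j<b. if True then d - ?q else 0))"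
          proof (rule runs_Sum_If, goal_cases)
            case (2 s4)
            then have "s4 ''cap'' = s ''cap''" using s3' by simp
            then show ?case using s by simp
          next
            case (4 s4 j)
            then have "s4 ''in'' = s ''in''" "s4 ''q'' 0 = ?q" using s3' by simp_all
            then show ?case using s by simp
          qed (use bn in auto)
          fix s4 assume f4: "\<And>y. y \<notin> assigned ?sum \<Longrightarrow> s4 y = s3 y"
            and s4: "s4 ''c'' 0 = s3 ''c'' 0 + (\<Sum>j<b. if True then d - ?q else 0)"
          have "s4 ''q'' 0 = ?q" "s4 ''cp'' = s2 ''cp''" using f4 s3' by simp_all
          then show "runs (Write ''cp'' (Var ''q'') (Var ''c'')) s4 10 ?post"
            using s4 s3 s2 by (intro runs_straight) (auto simp: mult.commute)
        qed
      qed
    qed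
  qed
qed auto

section \<open>The decision procedure\<close>

text \<open>The whole vertex set is a cover because edges are nonempty, so the least number is
  attained.\<close>

lemma vertex_cover_number_attained:
  assumes "simple_graph V E"
  obtains K where "vertex_cover V E K" "card K = vertex_cover_number V E"
proof -
  have "\<forall>e\<in>E. e \<inter> V \<noteq> {}"
    using assms by (auto simp: simple_graph_def card_2_iff)
  then have "\<exists>m C. vertex_cover V E C \<and> card C = m"
    by (auto simp: vertex_cover_def)
  then have "\<exists>C. vertex_cover V E C \<and> card C = vertex_cover_number V E"
    unfolding vertex_cover_number_def by (rule LeastI_ex)
  then show ?thesis using that by blast
qed

lemma greedy_cover_final:
  assumes C: "greedy_cover n E s n 0 C" and G: "simple_graph {..<n} E"
  shows "vertex_cover {..<n} E C" "card C \<le> 2 * vertex_cover_number {..<n} E" "card C \<le> n"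
proof -
  show "vertex_cover {..<n} E C"
    unfolding vertex_cover_def
  proof (intro conjI ballI)
    show sub: "C \<subseteq> {..<n}" using C by (simp add: greedy_cover_def)
    fix e assume e: "e \<in> E"
    then obtain u v where uv: "e = {u, v}" "u < n"
      using G by (fastforce simp: simple_graph_def card_2_iff)
    then have "u \<in> C \<or> v \<in> C" using C e by (simp add: greedy_cover_def)
    then show "e \<inter> C \<noteq> {}" using uv by auto
  qed
  obtain K where K: "vertex_cover {..<n} E K" "card K = vertex_cover_number {..<n} E"
    using vertex_cover_number_attained[OF G] by blast
  have "finite K" using K(1) finite_subset by (auto simp: vertex_cover_def)
  then have "card (C \<inter> K) \<le> card K" by (intro card_mono) auto
  moreover have "card C \<le> 2 * card (C \<inter> K)" using C K(1) by (simp add: greedy_cover_def)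
  ultimately show "card C \<le> 2 * vertex_cover_number {..<n} E" using K(2) by simp
  have "C \<subseteq> {..<n}" using C by (simp add: greedy_cover_def)
  from card_mono[OF _ this] show "card C \<le> n" by simp
qed

text \<open>\<open>H\<close> is the machine's \<open>h\<close> with \<open>card C\<close> replaced
  by its bound of twice the vertex cover number, so the time depends on the graph only through
  \<open>n\<close> and the parameter. The search dominates with a cube in each of the two
  factors.\<close>

lemma runs_Balanced:
  assumes G: "simple_graph {..<n} E" and d: "d > 0"
    and input: "s ''in'' 0 = n" "s ''in'' (Suc 0) = k" "s ''in'' 2 = d"
    and adj: "\<And>u v. u < n \<Longrightarrow> v < n \<Longrightarrow> s ''in'' (3 + v * n + u) = of_bool ({v, u} \<in> E)"
    and zero: "\<And>w. s ''cv'' w = 0" "s ''m'' 0 = 0" "s ''out'' 0 = 0"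
    and H: "H = 2 ^ 2 ^ (2 * vertex_cover_number {..<n} E + 3)"
  shows "runs Balanced s ((n + 4) ^ 3 * H ^ 3 * 4096)
    (\<lambda>s'. s' ''out'' 0 = (if has_balanced_partition {..<n} E k d then 1 else 0))"
proof -
  let ?R = "n + 4"
  let ?Q = "\<lambda>s'. s' ''out'' 0 = (if has_balanced_partition {..<n} E k d then 1 else 0)"
  let ?T6 = "2 * H * (?R * ?R * ?R * H * H * 1500)"
  let ?T5 = "H * 40 + ?T6"
  let ?T4 = "?R * 34 + ?T5"
  let ?T3 = "?R * 70 + ?T4"
  let ?T2 = "(7 + ?R * 40) + ?T3"
  let ?T1 = "?R * (?R * 120) + ?T2"
  have "runs Balanced s ((3 + ?R * 30) + ?T1) ?Q"
    unfolding Balanced_def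
  proof (rule runs_Seq[OF runs_Rows[of s n]])
    show "s ''in'' 0 = n" by (rule input)
    fix s1 assume f1: "\<And>y. y \<notin> assigned Rows \<Longrightarrow> s1 y = s y" and row: "\<forall>i\<le>n. s1 ''row'' i = 3 + i * n"
    have s1: "s1 ''in'' = s ''in''" "s1 ''cv'' = s ''cv''" "s1 ''m'' = s ''m''" "s1 ''out'' = s ''out''"
      using f1 by simp_all
    show "runs (Seq Cover (Seq Part_Bound (Seq Sink_Caps (Seq (Pow2 ''e'' (Add (Var ''m'') (Const 3)))
      (Seq (Pow2 ''h'' (Var ''e'')) Search))))) s1 ?T1 ?Q"
    proof (rule runs_Seq[OF runs_Cover[OF G, of s1]])
      fix s2 assume f2: "\<And>y. y \<notin> assigned Cover \<Longrightarrow> s2 y = s1 y" and "\<exists>C. greedy_cover n E s2 n 0 C"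
      then obtain C where C: "greedy_cover n E s2 n 0 C" by blast
      note gc = greedy_cover_final[OF C G]
      have s2: "s2 ''in'' = s ''in''" "s2 ''row'' = s1 ''row''" "s2 ''out'' = s ''out''"
        using f2 s1 by simp_all
      interpret covered_graph n E k d C
        using G d gc(1) by unfold_locales
      show "runs (Seq Part_Bound (Seq Sink_Caps (Seq (Pow2 ''e'' (Add (Var ''m'') (Const 3)))
        (Seq (Pow2 ''h'' (Var ''e'')) Search)))) s2 ?T2 ?Q"
      proof (rule runs_Seq[OF runs_Part_Bound[where n = n and d = d]])
        fix s3 assume f3: "\<And>y. y \<notin> assigned Part_Bound \<Longrightarrow> s3 y = s2 y"
          and cap: "s3 ''cap'' 0 = part_bound n d"
        have s3: "s3 ''in'' = s ''in''" "s3 ''row'' = s1 ''row''" "s3 ''out'' = s ''out''"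
          "s3 ''cv'' = s2 ''cv''" "s3 ''pos'' = s2 ''pos''" "s3 ''m'' = s2 ''m''"
          using f3 s2 by simp_all
        have m: "s2 ''m'' 0 = card C" using C by (simp add: greedy_cover_def)
        have pb: "part_bound n d \<le> n" using d by (rule part_bound_le)
        show "runs (Seq Sink_Caps (Seq (Pow2 ''e'' (Add (Var ''m'') (Const 3)))
          (Seq (Pow2 ''h'' (Var ''e'')) Search))) s3 ?T3 ?Q"
        proof (rule runs_Seq[OF runs_Sink_Caps[where s = s3 and d = d and b = "part_bound n d" and m = "card C" and n = n]])
          fix s4 assume f4: "\<And>y. y \<notin> assigned Sink_Caps \<Longrightarrow> s4 y = s3 y"
            and caps: "s4 ''q'' 0 = min (card C) d \<and> (\<forall>i\<le>min (card C) d. s4 ''cp'' i =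
              (if i < min (card C) d then part_bound n d else (d - min (card C) d) * part_bound n d))"
          have s4: "s4 ''in'' = s ''in''" "s4 ''row'' = s1 ''row''" "s4 ''out'' = s ''out''"
            "s4 ''cv'' = s2 ''cv''" "s4 ''pos'' = s2 ''pos''" "s4 ''m'' = s2 ''m''" "s4 ''cap'' = s3 ''cap''"
            using f4 s3 by simp_all
          have pow_e: "runs (Pow2 ''e'' (Add (Var ''m'') (Const 3))) s4 (?R * 34)
            (\<lambda>s'. s' ''e'' 0 = 2 ^ (card C + 3))"
            using runs_Pow2[of "''e''" s4 "Add (Var ''m'') (Const 3)" "card C + 3" ?R] s4 m gc(3)
            by simp
          show "runs (Seq (Pow2 ''e'' (Add (Var ''m'') (Const 3)))
            (Seq (Pow2 ''h'' (Var ''e'')) Search)) s4 ?T4 ?Q"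
          proof (rule runs_Seq[OF pow_e])
            fix s5 assume f5: "\<And>y. y \<notin> assigned (Pow2 ''e'' (Add (Var ''m'') (Const 3))) \<Longrightarrow> s5 y = s4 y"
              and e5: "s5 ''e'' 0 = 2 ^ (card C + 3)"
            have s5: "s5 ''in'' = s ''in''" "s5 ''row'' = s1 ''row''" "s5 ''out'' = s ''out''"
              "s5 ''cv'' = s2 ''cv''" "s5 ''pos'' = s2 ''pos''" "s5 ''m'' = s2 ''m''" "s5 ''cap'' = s3 ''cap''"
              "s5 ''q'' = s4 ''q''" "s5 ''cp'' = s4 ''cp''"
              using f5 s4 by simp_all
            have exp: "2 ^ (card C + 3) \<le> (2::nat) ^ (2 * vertex_cover_number {..<n} E + 3)"
              using gc(2) by (intro power_increasing) auto
            then have h_le: "2 ^ 2 ^ (card C + 3) \<le> H"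
              unfolding H by (intro power_increasing) auto
            have "2 ^ (card C + 3) < (2::nat) ^ 2 ^ (card C + 3)" by (rule less_exp)
            with h_le have "s5 ''e'' 0 + 1 \<le> H" using e5 by linarith
            then have pow_h: "runs (Pow2 ''h'' (Var ''e'')) s5 (H * 40) (\<lambda>s'. s' ''h'' 0 = 2 ^ s5 ''e'' 0)"
              by (intro runs_conseq[OF runs_Pow2[where N = "s5 ''e'' 0" and A = H]]) auto
            show "runs (Seq (Pow2 ''h'' (Var ''e'')) Search) s5 ?T5 ?Q"
            proof (rule runs_Seq[OF pow_h])
              fix s6 assume f6: "\<And>y. y \<notin> assigned (Pow2 ''h'' (Var ''e'')) \<Longrightarrow> s6 y = s5 y"
                and h6: "s6 ''h'' 0 = 2 ^ s5 ''e'' 0"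
              have s6: "s6 ''in'' = s ''in''" "s6 ''row'' = s1 ''row''" "s6 ''out'' = s ''out''"
                "s6 ''cv'' = s2 ''cv''" "s6 ''pos'' = s2 ''pos''" "s6 ''m'' = s2 ''m''" "s6 ''cap'' = s3 ''cap''"
                "s6 ''q'' = s4 ''q''" "s6 ''cp'' = s4 ''cp''" "s6 ''e'' = s5 ''e''"
                using f6 s5 by simp_all
              interpret loaded_graph n E k d C s6
              proof unfold_locales
                show "s6 ''in'' (s6 ''row'' v + u) = of_bool ({v, u} \<in> E)" if "u < n" "v < n" for u v
                  using adj[OF that] row that by (simp add: s6)
                show "s6 ''cp'' i = sink_cap i" if "i \<le> q" for i
                  using caps that by (simp add: s6 sink_cap_def q_def)
              qed (use C caps cap e5 h6 input in \<open>simp_all add: s6 greedy_cover_def q_def\<close>)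
              have "agree s6" by (simp add: agree_def)
              then have "runs Search s6 (2 * h\<^sub>0 * (K * h\<^sub>0 * 1500))
                  (\<lambda>s'. s' ''out'' 0 = (if \<exists>N<h\<^sub>0. accepts N then 1 else 0))"
                by (rule runs_Search) (simp add: s6 zero)
              moreover have "2 * h\<^sub>0 * (K * h\<^sub>0 * 1500) \<le> ?T6"
                using h_le by (intro mult_le_mono order_refl) (simp_all add: h6 e5)
              ultimately show "runs Search s6 ?T6 ?Q"
                by (rule runs_conseq) (simp add: ex_accepts_iff)
            qed
          qed
        qed (use s3 m input cap gc(3) pb in simp_all)
      qed (use s2 input d in simp_all)
    qed (use s1 input zero row adj in simp_all)
  qed
  moreover have "(3 + ?R * 30) + ?T1 \<le> ?R ^ 3 * H ^ 3 * 4096"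
  proof -
    \<comment> \<open>Every term of the time bound is a multiple of a monomial below
      \<open>Z\<close>; the coefficients add up to less than 4096.\<close>
    define Z where "Z = ?R ^ 3 * H ^ 3"
    have H1: "1 \<le> H" by (simp add: H)
    have R1: "1 \<le> ?R" by simp
    have "?R ^ 1 * H ^ 0 \<le> Z" "?R ^ 2 * H ^ 0 \<le> Z" "?R ^ 0 * H ^ 1 \<le> Z" "?R ^ 0 * H ^ 0 \<le> Z"
      unfolding Z_def by (intro mult_le_mono power_increasing R1 H1; simp)+
    then have Z: "?R \<le> Z" "?R * ?R \<le> Z" "H \<le> Z" "1 \<le> Z"
      by (simp_all only: power_0 power_one_right mult_1 mult_1_right power2_eq_square)
    have "(3 + ?R * 30) + ?T1 = ?R * 174 + ?R * ?R * 120 + H * 40 + 10 + Z * 3000"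
      unfolding Z_def by (simp add: power3_eq_cube algebra_simps)
    also have "\<dots> \<le> Z * 174 + Z * 120 + Z * 40 + Z * 10 + Z * 3000"
      using Z by (intro add_mono mult_le_mono1 order_refl) simp_all
    finally show ?thesis unfolding Z_def[symmetric] by simp
  qed
  ultimately show ?thesis by (rule runs_conseq)
qed

section \<open>Layout and size of the encoded instance\<close>

lemma length_concat_table: "length (concat (map (\<lambda>v. map (f v) [0..<n]) [0..<r])) = r * n"
  by (induction r) auto

lemma nth_concat_table:
  assumes "v < r" "u < n"
  shows "concat (map (\<lambda>v. map (f v) [0..<n]) [0..<r]) ! (v * n + u) = f v u"
  using assms
proof (induction r)
  case (Suc r)
  show ?case
  proof (cases "v = r")
    case True
    then show ?thesis using Suc.prems by (simp add: nth_append length_concat_table)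
  next
    case False
    then have v: "v < r" using Suc.prems by simp
    have "v * n + u < Suc v * n" using Suc.prems by simp
    also have "\<dots> \<le> r * n" using v by (intro mult_le_mono1) simp
    finally show ?thesis using Suc v by (simp add: nth_append length_concat_table)
  qed
qed simp

lemma input_size_ge_length: "length xs \<le> input_size xs"
  unfolding input_size_def by (induction xs) auto

lemma bp_encode_eq: "bp_encode (n, E, k, d) =
    n # k # d # concat (map (\<lambda>v. map (\<lambda>u. of_bool ({v, u} \<in> E)) [0..<n]) [0..<n])"
  by (simp add: of_bool_def)

text \<open>The three leading numbers contribute a delimiter each, a positive \<open>k\<close> has a
  digit, and the matrix has \<open>n * n\<close> entries.\<close>

lemma input_size_bp_encode_ge:
  assumes "k > 0"
  shows "n + 4 \<le> input_size (bp_encode (n, E, k, d))"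
proof -
  let ?M = "concat (map (\<lambda>v. map (\<lambda>u. of_bool ({v, u} \<in> E)) [0..<n]) [0..<n]) :: nat list"
  have "floorlog 2 k \<noteq> 0" using assms by (simp add: floorlog_eq_zero_iff)
  moreover have "n * n \<le> input_size ?M"
    using input_size_ge_length[of ?M] by (simp only: length_concat_table)
  moreover have "n \<le> n * n" by simp
  moreover have "input_size (bp_encode (n, E, k, d)) =
      3 + floorlog 2 n + floorlog 2 k + floorlog 2 d + input_size ?M"
    unfolding bp_encode_eq by (simp add: input_size_def)
  ultimately show ?thesis by linarith
qed

text \<open>The parameter function of the theorem. Its exponent has 5 where \<open>H\<close> has 3,
  which amounts to the fourth power of \<open>H\<close>.\<close>

lemma computable_double_exp: "computable (\<lambda>x. 2 ^ 2 ^ (2 * x + 5))"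
  unfolding computable_def
proof (rule exI, rule allI)
  fix x
  let ?a = "Add (Add (Var ''in'') (Var ''in'')) (Const 5)"
  let ?c = "Seq (Pow2 ''y'' ?a) (Pow2 ''out'' (Var ''y''))"
  let ?s = "initial [x]"
  have "runs ?c ?s ((2 * x + 6) * (acost ?a + 30) + (2 ^ (2 * x + 5) + 1) * (acost (Var ''y'') + 30))
      (\<lambda>s'. s' ''out'' 0 = 2 ^ 2 ^ (2 * x + 5))"
  proof (rule runs_Seq)
    show "runs (Pow2 ''y'' ?a) ?s ((2 * x + 6) * (acost ?a + 30)) (\<lambda>s'. s' ''y'' 0 = 2 ^ (2 * x + 5))"
      by (rule runs_Pow2) (auto simp: initial_def)
    show "runs (Pow2 ''out'' (Var ''y'')) s' ((2 ^ (2 * x + 5) + 1) * (acost (Var ''y'') + 30))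
        (\<lambda>s'. s' ''out'' 0 = 2 ^ 2 ^ (2 * x + 5))" if "s' ''y'' 0 = 2 ^ (2 * x + 5)" for s'
      using that by (intro runs_Pow2) auto
  qed
  then show "\<exists>t s. exec ?c ?s t s \<and> result s = 2 ^ 2 ^ (2 * x + 5)"
    by (auto simp: runs_def result_def)
qed

theorem theorem10:
  "fixed_parameter_tractable bp_instances bp_encode balanced_partitioning bp_vertex_cover_number"
  unfolding fixed_parameter_tractable_def
proof ((rule exI)+, intro conjI ballI)
  show "computable (\<lambda>x. 2 ^ 2 ^ (2 * x + 5))" by (rule computable_double_exp)
  fix x assume "x \<in> bp_instances"
  then obtain n E k d where x: "x = (n, E, k, d)" and G: "simple_graph {..<n} E" and kd: "k > 0" "d > 0"
    by (auto simp: bp_instances_def)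
  define S where "S = input_size (bp_encode x)"
  define \<tau> where "\<tau> = vertex_cover_number {..<n} E"
  define H :: nat where "H = 2 ^ 2 ^ (2 * \<tau> + 3)"
  define M :: "nat list" where "M = concat (map (\<lambda>v. map (\<lambda>u. of_bool ({v, u} \<in> E)) [0..<n]) [0..<n])"
  have enc: "bp_encode x = n # k # d # M" unfolding x bp_encode_eq M_def ..
  have len: "length M = n * n" by (simp only: M_def length_concat_table)
  have "runs Balanced (initial (bp_encode x)) ((n + 4) ^ 3 * H ^ 3 * 4096)
    (\<lambda>s'. s' ''out'' 0 = (if has_balanced_partition {..<n} E k d then 1 else 0))"
  proof (rule runs_Balanced[OF G kd(2)])
    show "initial (bp_encode x) ''in'' (3 + v * n + u) = of_bool ({v, u} \<in> E)" if "u < n" "v < n" for u v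
    proof -
      have "v * n + u < Suc v * n" using that by simp
      also have "\<dots> \<le> n * n" using that by (intro mult_le_mono1) simp
      finally show ?thesis
        using nth_concat_table[OF that(2,1), of "\<lambda>v u. of_bool ({v, u} \<in> E)"] len
        by (simp add: enc initial_def M_def eval_nat_numeral)
    qed
    show "H = 2 ^ 2 ^ (2 * vertex_cover_number {..<n} E + 3)" by (simp only: H_def \<tau>_def)
  qed (simp_all add: enc initial_def)
  then obtain t s where ts: "exec Balanced (initial (bp_encode x)) t s" "t \<le> (n + 4) ^ 3 * H ^ 3 * 4096"
    "s ''out'' 0 = (if has_balanced_partition {..<n} E k d then 1 else 0)"
    by (auto simp: runs_def)
  have "t \<le> 2 ^ 2 ^ (2 * \<tau> + 5) * S ^ 15"
  proof -
    have S: "n + 4 \<le> S" unfolding S_def x using kd(1) by (rule input_size_bp_encode_ge)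
    \<comment> \<open>Rounding the cube up to a fourth power keeps the exponent of 2 a power of
      two.\<close>
    have "H ^ 3 \<le> H ^ 4" by (rule power_increasing) (simp_all add: H_def)
    also have "H ^ 4 = 2 ^ (2 ^ (2 * \<tau> + 3) * 2 ^ 2)"
      unfolding H_def power_mult[symmetric] by simp
    also have "2 ^ (2 * \<tau> + 3) * 2 ^ 2 = (2::nat) ^ (2 * \<tau> + 5)"
      by (simp add: power_add)
    finally have "H ^ 3 \<le> 2 ^ 2 ^ (2 * \<tau> + 5)" .
    moreover have "(n + 4) ^ 3 \<le> S ^ 3" using S by (rule power_mono) simp
    \<comment> \<open>The constant \<open>2 ^ 12\<close> is absorbed by the polynomial, as the input
      size is at least 4. With the cube this gives the exponent 15.\<close>
    moreover have "4096 \<le> S ^ 12"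
    proof -
      have "(2::nat) ^ 12 \<le> S ^ 12" using S by (intro power_mono) simp_all
      then show ?thesis by simp
    qed
    ultimately have "(n + 4) ^ 3 * H ^ 3 * 4096 \<le> S ^ 3 * 2 ^ 2 ^ (2 * \<tau> + 5) * S ^ 12"
      by (intro mult_le_mono)
    also have "\<dots> = 2 ^ 2 ^ (2 * \<tau> + 5) * (S ^ 3 * S ^ 12)" by (simp only: ac_simps)
    also have "S ^ 3 * S ^ 12 = S ^ 15" by (simp add: power_add[symmetric])
    finally show ?thesis using ts(2) by simp
  qed
  then show "\<exists>t s. exec Balanced (initial (bp_encode x)) t s \<and>
      result s = (if balanced_partitioning x then 1 else 0) \<and>
      t \<le> 2 ^ 2 ^ (2 * bp_vertex_cover_number x + 5) * input_size (bp_encode x) ^ 15"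
    using ts(1,3) by (intro exI[of _ t] exI[of _ s]) (simp add: x result_def S_def \<tau>_def)
qed

end
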